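(* Let $\ell \ge 2$ be a fixed integer. Suppose $G$ is a $\mathcal{C}_{2\ell}$-free bipartite graph on $n$ vertices with parts $X$ and $Y$ and average degree $d \sim (n/2)^{1/\ell}$. Then for any $S \subseteq X$ and $T \subseteq Y$ we have $$e(S,T) = \frac{2d}{n}|S||T| + o(n^{1+1/\ell}).$$
   Context: Graphs are finite and simple. $C_j$ denotes the cycle of length $j$, and $\mathcal{C}_{2\ell} = \{C_4, C_6, \dots, C_{2\ell}\}$. A graph is $\mathcal{C}_{2\ell}$-free if it contains no member of $\mathcal{C}_{2\ell}$ as a (not necessarily induced) subgraph. For $S,T \subseteq V(G)$, $e(S,T)$ is the number of ordered pairs $(s,t)$ with $s \in S$, $t \in T$ and $st \in E(G)$. Asymptotic notation is as $n \to \infty$ with $\ell$ fixed: the statement concerns sequences of graphs $G$ (with $n \to \infty$) together with choices of $S,T$, $f \sim g$ means $f/g \to 1$, and the error term $o(n^{1+1/\ell})$ is uniform over all choices of $S$ and $T$. *)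

theory Defs
  imports
    Complex_Main
    "HOL-Library.Landau_Symbols"
    "Graph_Theory.Graph_Theory"
begin

text \<open>
  A finite simple graph is a \<^locale>\<open>pair_graph\<close>: the arc set is a symmetric irreflexive relation
  on the finite vertex set, so every undirected edge occurs as two arcs.
\<close>

text \<open>The cycle on the vertices \<open>0, \<dots>, j - 1\<close>; only meaningful for \<open>j \<ge> 3\<close>.\<close>

definition cycle_graph :: "nat \<Rightarrow> nat pair_pre_digraph" where
  "cycle_graph j = \<lparr> pverts = {..<j},
     parcs = {(u, v). u < j \<and> v < j \<and> (v = Suc u mod j \<or> u = Suc v mod j)} \<rparr>"

lemma pair_graph_cycle_graph:
  assumes "j \<ge> 3"
  shows "pair_graph (cycle_graph j)"
proof
  have "parcs (cycle_graph j) \<subseteq> {..<j} \<times> {..<j}"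
    by (auto simp: cycle_graph_def)
  then show "finite (parcs (cycle_graph j))"
    by (rule finite_subset) auto
next
  fix e assume "e \<in> parcs (cycle_graph j)"
  then show "fst e \<noteq> snd e"
    using assms by (auto simp: cycle_graph_def mod_Suc split: if_splits)
qed (auto simp: cycle_graph_def symmetric_def sym_def)

definition even_cycles :: "nat \<Rightarrow> nat pair_pre_digraph set" where
  "even_cycles l = {cycle_graph (2 * k) | k. 2 \<le> k \<and> k \<le> l}"

text \<open>Containment as a not necessarily induced subgraph.\<close>

definition contains_copy :: "'a pair_pre_digraph \<Rightarrow> 'b pair_pre_digraph \<Rightarrow> bool" where
  "contains_copy G F \<longleftrightarrow>
     (\<exists>H. subgraph (with_proj H) (with_proj G) \<and> digraph_iso (with_proj F) (with_proj H))"

definition family_free :: "'b pair_pre_digraph set \<Rightarrow> 'a pair_pre_digraph \<Rightarrow> bool" where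
  "family_free \<F> G \<longleftrightarrow> (\<forall>F\<in>\<F>. \<not> contains_copy G F)"

definition bipartite_with_parts :: "'a pair_pre_digraph \<Rightarrow> 'a set \<Rightarrow> 'a set \<Rightarrow> bool" where
  "bipartite_with_parts G X Y \<longleftrightarrow>
     pverts G = X \<union> Y \<and> X \<inter> Y = {} \<and> parcs G \<subseteq> X \<times> Y \<union> Y \<times> X"

text \<open>In the symmetric representation the degree of a vertex is its out-degree.\<close>

definition average_degree :: "'a pair_pre_digraph \<Rightarrow> real" where
  "average_degree G =
     (\<Sum>v\<in>pverts G. real (out_degree (with_proj G) v)) / real (card (pverts G))"

definition edge_count :: "'a pair_pre_digraph \<Rightarrow> 'a set \<Rightarrow> 'a set \<Rightarrow> nat" where
  "edge_count G S T = card {(s, t). s \<in> S \<and> t \<in> T \<and> (s, t) \<in> parcs G}"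

end

(*
  Write M = n/2, so that d is about D = M^(1/l). Bipartite graphs without the given cycles have
  girth above 2l, so non-backtracking walks of length at most l with a common start are determined
  by their endpoint. Discarding at most eps d n edges makes all degrees of non-isolated vertices
  at least eps d, and counting the endpoints of such walks then bounds the maximum degree by O(D).
  Hence all but o(M) of the walks of length l from a vertex are non-backtracking: the l-th power
  of the adjacency operator A has zero-one entries up to an o(M) error in each row sum.
  Log-convexity of k |-> |A^k f|^2 bounds |A^l 1_X|^2 from below in terms of the number of edges;
  comparison with the trivial upper bounds shows that both parts have about M vertices and that
  almost all entries of A^l are one. So |A^l u|^2 = o(M^3) for bounded u on X with sum zero, and
  log-convexity again gives |A u|^2 = o(M D^2), which is the discrepancy bound.
*)
theory Submission
  imports Defs "HOL-Analysis.Convex" "HOL-Library.Indicator_Function"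
begin

section \<open>Adjacency operator and non-backtracking walks\<close>

definition adj :: "('a \<times> 'a) set \<Rightarrow> ('a \<Rightarrow> real) \<Rightarrow> 'a \<Rightarrow> real" where
  "adj E f x = sum f (E `` {x})"

text \<open>Endpoints of the non-backtracking walks of length \<open>k\<close> from \<open>x\<close> that do not step to \<open>y\<close> first.\<close>

primrec nb_ends :: "('a \<times> 'a) set \<Rightarrow> nat \<Rightarrow> 'a \<Rightarrow> 'a \<Rightarrow> 'a set" where
  "nb_ends E 0 y x = {x}"
| "nb_ends E (Suc k) y x = (\<Union>x' \<in> E `` {x} - {y}. nb_ends E k x x')"

definition nb_walk :: "('a \<times> 'a) set \<Rightarrow> nat \<Rightarrow> (nat \<Rightarrow> 'a) \<Rightarrow> bool" where
  "nb_walk E m w \<longleftrightarrow> (\<forall>i<m. (w i, w (Suc i)) \<in> E) \<and> (\<forall>i. i + 2 \<le> m \<longrightarrow> w i \<noteq> w (i + 2))"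

lemma adj_scale: "adj E (\<lambda>x. c * f x) = (\<lambda>x. c * adj E f x)"
  by (auto simp: adj_def sum_distrib_left)

lemma adj_diff: "adj E (\<lambda>x. f x - g x) = (\<lambda>x. adj E f x - adj E g x)"
  by (auto simp: adj_def sum_subtractf)

text \<open>Converts the recursive sets of endpoints into walks, on which the girth argument works.
  A walk of length 0 has no first step, so \<open>w 1\<close> is constrained only for positive
  \<open>k\<close>.\<close>

lemma nb_walk_of_nb_ends:
  assumes "z \<in> nb_ends E k y x"
  obtains w where "nb_walk E k w" "w 0 = x" "w k = z" "k > 0 \<longrightarrow> w 1 \<noteq> y"
  using assms
proof (induction k arbitrary: y x thesis)
  case 0
  then show ?case by (auto simp: nb_walk_def)
next
  case (Suc k)
  from Suc.prems(2) obtain x' where x': "(x, x') \<in> E" "x' \<noteq> y" "z \<in> nb_ends E k x x'"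
    by auto
  from Suc.IH[OF _ x'(3)] obtain w where
    w: "nb_walk E k w" "w 0 = x'" "w k = z" "k > 0 \<longrightarrow> w 1 \<noteq> x" by metis
  show ?case
  proof (rule Suc.prems(1)[of "case_nat x w"])
    show "nb_walk E (Suc k) (case_nat x w)"
      using w x' by (auto simp: nb_walk_def split: nat.splits)
  qed (use w x' in auto)
qed

section \<open>Self-adjointness and log-convexity of energies\<close>

locale bipartite_arcs =
  fixes X Y :: "'a set" and E :: "('a \<times> 'a) set"
  assumes finite_X: "finite X" and finite_Y: "finite Y"
    and disjoint: "X \<inter> Y = {}"
    and arcs_subset: "E \<subseteq> X \<times> Y \<union> Y \<times> X"
    and sym_arcs: "sym E"
begin

lemma swap: "bipartite_arcs Y X E"
  using finite_X finite_Y disjoint arcs_subset sym_arcs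
  by unfold_locales auto

lemma finite_nbh: "finite (E `` A)"
proof (rule finite_subset)
  show "E `` A \<subseteq> X \<union> Y" using arcs_subset by auto
qed (use finite_X finite_Y in auto)

lemma nbh_X: "x \<in> X \<Longrightarrow> E `` {x} \<subseteq> Y"
  using arcs_subset disjoint by auto

lemma nbh_Y: "x \<in> Y \<Longrightarrow> E `` {x} \<subseteq> X"
  using arcs_subset disjoint by auto

lemma nbh_outside: "x \<notin> X \<union> Y \<Longrightarrow> E `` {x} = {}"
  using arcs_subset by auto

lemma finite_nb_ends: "finite (nb_ends E k y x)"
  by (induction k arbitrary: y x) (auto intro: finite_nbh)

definition nsq :: "('a \<Rightarrow> real) \<Rightarrow> real" where
  "nsq f = (\<Sum>x\<in>X \<union> Y. (f x)\<^sup>2)"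

lemma nsq_nonneg: "nsq f \<ge> 0"
  by (simp add: nsq_def sum_nonneg)

text \<open>Both sides are sums over the arcs, and reversing every arc by \<open>prod.swap\<close>
  exchanges them because \<open>E\<close> is symmetric.\<close>

lemma adj_self_adjoint:
  "(\<Sum>x\<in>X \<union> Y. adj E f x * g x) = (\<Sum>x\<in>X \<union> Y. f x * adj E g x)"
proof -
  have E: "Sigma (X \<union> Y) (\<lambda>x. E `` {x}) = E" using arcs_subset by auto
  have "(\<Sum>x\<in>X \<union> Y. adj E f x * g x) = (\<Sum>x\<in>X \<union> Y. \<Sum>y\<in>E `` {x}. f y * g x)"
    by (simp add: adj_def sum_distrib_right)
  also have "\<dots> = (\<Sum>(x, y)\<in>E. f y * g x)"
    using finite_X finite_Y finite_nbh by (subst sum.Sigma) (auto simp: E)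
  also have "\<dots> = (\<Sum>(x, y)\<in>E. f x * g y)"
    using sym_arcs
    by (intro sum.reindex_bij_witness[where i = prod.swap and j = prod.swap])
       (auto dest: symD)
  also have "\<dots> = (\<Sum>x\<in>X \<union> Y. \<Sum>y\<in>E `` {x}. f x * g y)"
    using finite_X finite_Y finite_nbh by (subst sum.Sigma) (auto simp: E)
  also have "\<dots> = (\<Sum>x\<in>X \<union> Y. f x * adj E g x)"
    by (simp add: adj_def sum_distrib_left)
  finally show ?thesis .
qed

text \<open>By self-adjointness \<open>nsq (adj E f)\<close> is the inner product of
  \<open>f\<close> with \<open>adj E (adj E f)\<close>, so this is Cauchy-Schwarz.\<close>

lemma nsq_adj_log_convex:
  "(nsq (adj E f))\<^sup>2 \<le> nsq f * nsq (adj E (adj E f))"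
proof -
  have "nsq (adj E f) = (\<Sum>x\<in>X \<union> Y. f x * adj E (adj E f) x)"
    using adj_self_adjoint[of f "adj E f"] by (simp add: nsq_def power2_eq_square)
  then show ?thesis
    unfolding nsq_def using Cauchy_Schwarz_ineq_sum[of f "adj E (adj E f)" "X \<union> Y"] by simp
qed

end

text \<open>Log-convexity makes the ratios \<open>s (Suc k) / s k\<close> nondecreasing, so each is
  at least \<open>s 1 / s 0\<close>; multiplying them gives the bound. Everything is
  cross-multiplied so that zero terms are covered.\<close>

lemma log_convex_power_le:
  fixes s :: "nat \<Rightarrow> real"
  assumes nonneg: "\<And>k. s k \<ge> 0" and convex: "\<And>k. (s (Suc k))\<^sup>2 \<le> s k * s (Suc (Suc k))"
  shows "s 1 ^ Suc k \<le> s (Suc k) * s 0 ^ k"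
proof -
  have ratio: "s k * s 1 \<le> s (Suc k) * s 0" for k
  proof (induction k)
    case (Suc k)
    show ?case
    proof (cases "s k = 0")
      \<comment> \<open>Convexity then forces \<open>s (Suc k) = 0\<close>, so the left side
        vanishes.\<close>
      case True
      then show ?thesis using convex[of k] nonneg by simp
    next
      case False
      then have pos: "s k > 0" using nonneg[of k] by simp
      have "s k * (s (Suc k) * s 1) \<le> s (Suc k) * (s (Suc k) * s 0)"
        using mult_left_mono[OF Suc nonneg[of "Suc k"]] by (simp add: mult_ac)
      also have "\<dots> \<le> s k * (s (Suc (Suc k)) * s 0)"
        using mult_right_mono[OF convex[of k] nonneg[of 0]] by (simp add: power2_eq_square mult_ac)
      finally show ?thesis using pos by simp
    qed
  qed (simp add: mult.commute)
  show ?thesis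
  proof (induction k)
    case (Suc k)
    have "s 1 ^ Suc (Suc k) = s 1 ^ Suc k * s 1" by simp
    also have "\<dots> \<le> (s (Suc k) * s 0 ^ k) * s 1"
      by (rule mult_right_mono[OF Suc nonneg])
    also have "\<dots> = (s (Suc k) * s 1) * s 0 ^ k" by (simp add: mult_ac)
    also have "\<dots> \<le> (s (Suc (Suc k)) * s 0) * s 0 ^ k"
      by (intro mult_right_mono ratio) (simp add: nonneg)
    finally show ?case by (simp add: mult_ac)
  qed simp
qed

section \<open>Powers of the adjacency operator\<close>

context bipartite_arcs
begin

text \<open>Serves twice: with \<open>indicator X\<close> it turns many edges into a lower bound for
  the energy of the \<open>l\<close>-th power, and with a centred indicator it turns a small energy
  of the \<open>l\<close>-th power into a small energy after one step.\<close>

lemma nsq_adj_power_le: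
  assumes "l \<ge> 1"
  shows "nsq (adj E f) ^ l \<le> nsq ((adj E ^^ l) f) * nsq f ^ (l - 1)"
proof -
  obtain k where "l = Suc k" using assms by (cases l) auto
  then show ?thesis
    using log_convex_power_le[of "\<lambda>k. nsq ((adj E ^^ k) f)" k] nsq_nonneg nsq_adj_log_convex
    by simp
qed

definition deg_le :: "real \<Rightarrow> bool" where
  "deg_le \<Delta> \<longleftrightarrow> \<Delta> \<ge> 0 \<and> (\<forall>x. real (card (E `` {x})) \<le> \<Delta>)"

lemma abs_adj_le:
  assumes "deg_le \<Delta>" "\<And>x. \<bar>f x\<bar> \<le> B" "B \<ge> 0"
  shows "\<bar>adj E f x\<bar> \<le> \<Delta> * B"
proof -
  have "\<bar>adj E f x\<bar> \<le> (\<Sum>y\<in>E `` {x}. \<bar>f y\<bar>)" by (simp add: adj_def sum_abs)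
  also have "\<dots> \<le> real (card (E `` {x})) * B"
    using sum_bounded_above[of "E `` {x}" "\<lambda>y. \<bar>f y\<bar>" B] assms by simp
  also have "\<dots> \<le> \<Delta> * B" using assms by (intro mult_right_mono) (auto simp: deg_le_def)
  finally show ?thesis .
qed

lemma abs_adj_power_le:
  assumes "deg_le \<Delta>" "\<And>x. \<bar>f x\<bar> \<le> 1"
  shows "\<bar>(adj E ^^ k) f x\<bar> \<le> \<Delta> ^ k"
proof (induction k arbitrary: x)
  case (Suc k)
  have "0 \<le> \<Delta>" using assms by (simp add: deg_le_def)
  then show ?case using abs_adj_le[OF assms(1) Suc] by simp
qed (use assms in simp)

text \<open>Every arc crosses between the parts, so each application of \<open>adj E\<close> moves
  the support to the opposite part.\<close>

lemma adj_power_parity: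
  assumes "\<And>x. x \<notin> X \<Longrightarrow> f x = 0"
  shows "z \<notin> (if even k then X else Y) \<Longrightarrow> (adj E ^^ k) f z = 0"
proof (induction k arbitrary: z)
  case (Suc k)
  have "E `` {z} \<inter> (if even k then X else Y) = {}"
    using Suc.prems nbh_X[of z] nbh_Y[of z] nbh_outside[of z] disjoint by (auto split: if_splits)
  then show ?case
    using Suc.IH by (auto simp: adj_def intro!: sum.neutral)
qed (use assms in simp)

lemma nb_ends_parity:
  "z \<in> (if even k then X else Y) \<Longrightarrow> nb_ends E k y z \<subseteq> X"
proof (induction k arbitrary: z y)
  case (Suc k)
  have "E `` {z} \<subseteq> (if even k then X else Y)"
    using Suc.prems nbh_X[of z] nbh_Y[of z] by (auto split: if_splits)
  then show ?case using Suc.IH by fastforce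
qed auto

end

section \<open>Non-backtracking walks under large girth\<close>

text \<open>Cycles appear as injective cyclic sequences, which keeps the walk arguments free of
  subgraphs and isomorphisms. As odd cycles cannot occur, the axiom says that the girth exceeds
  \<open>2 * l\<close>.\<close>

locale bipartite_girth = bipartite_arcs +
  fixes l :: nat
  assumes no_cycle: "\<And>k w. \<lbrakk>2 \<le> k; k \<le> l; inj_on w {..<2 * k};
    \<And>i. i < 2 * k \<Longrightarrow> (w i, w (Suc i mod (2 * k))) \<in> E\<rbrakk> \<Longrightarrow> False"
begin

lemma swap_girth: "bipartite_girth Y X E l"
  using swap no_cycle by (auto simp: bipartite_girth_def bipartite_girth_axioms_def)

text \<open>Two equal entries at the least positive distance \<open>t\<close> enclose a segment
  without repetitions, hence a cycle of length \<open>t\<close>. Bipartiteness makes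
  \<open>t\<close> even, and the absence of backtracking excludes \<open>t = 2\<close>.\<close>

lemma nb_walk_not_closed:
  assumes w: "nb_walk E m w" and m: "0 < m" "m \<le> 2 * l"
  shows "w 0 \<noteq> w m"
proof
  assume closed: "w 0 = w m"
  define P where "P t \<longleftrightarrow> t > 0 \<and> (\<exists>i. i + t \<le> m \<and> w i = w (i + t))" for t
  have "P m" using closed m by (auto simp: P_def)
  define t where "t = (LEAST t. P t)"
  have "P t" unfolding t_def using \<open>P m\<close> by (rule LeastI)
  then obtain i where i: "t > 0" "i + t \<le> m" "w i = w (i + t)" by (auto simp: P_def)
  have min: "\<not> P t'" if "t' < t" for t' using that not_less_Least unfolding t_def by blast
  have arc: "(w (i + s), w (i + Suc s)) \<in> E" if "s < t" for s
    using w i that by (auto simp: nb_walk_def)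
  have side: "(w (i + s) \<in> X \<longleftrightarrow> (w i \<in> X \<longleftrightarrow> even s)) \<and> (w (i + s) \<in> X \<union> Y)" if "s \<le> t" for s
    using that
  proof (induction s)
    case 0
    then show ?case using arc[of 0] i arcs_subset by auto
  next
    case (Suc s)
    then show ?case using arc[of s] arcs_subset disjoint by auto
  qed
  have "even t" using side[of t] i by auto
  have "t \<noteq> 2" using w i by (auto simp: nb_walk_def)
  obtain k where k: "t = 2 * k" using \<open>even t\<close> by auto
  show False
  proof (rule no_cycle[of k "\<lambda>s. w (i + s)"])
    show "2 \<le> k" using k \<open>t \<noteq> 2\<close> i by auto
    show "k \<le> l" using k i m by auto
    show "inj_on (\<lambda>s. w (i + s)) {..<2 * k}"
    proof (rule linorder_inj_onI)
      fix a b assume ab: "a < b" "a \<in> {..<2 * k}" "b \<in> {..<2 * k}"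
      show "w (i + a) \<noteq> w (i + b)"
      proof
        assume eq: "w (i + a) = w (i + b)"
        have "P (b - a)" unfolding P_def
          by (intro conjI exI[of _ "i + a"]) (use ab i eq k in auto)
        then show False using min[of "b - a"] ab k by (auto simp: less_imp_diff_less)
      qed
    qed auto
  next
    fix s assume "s < 2 * k"
    then show "(w (i + s), w (i + Suc s mod (2 * k))) \<in> E"
      using arc[of s] i k by (cases "Suc s = 2 * k") auto
  qed
qed

text \<open>Two walks from different neighbours of \<open>x\<close> to a common endpoint, neither
  stepping to \<open>x\<close> first, join through \<open>x\<close> to a closed non-backtracking
  walk of length \<open>2 * k + 2\<close>, which is at most \<open>2 * l\<close>.\<close>

lemma nb_ends_disjoint:
  assumes "k < l" "x' \<in> E `` {x}" "x'' \<in> E `` {x}" "x' \<noteq> x''"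
  shows "nb_ends E k x x' \<inter> nb_ends E k x x'' = {}"
proof (rule ccontr)
  assume "\<not> ?thesis"
  then obtain z where z: "z \<in> nb_ends E k x x'" "z \<in> nb_ends E k x x''" by auto
  obtain p where p: "nb_walk E k p" "p 0 = x'" "p k = z" "k > 0 \<longrightarrow> p 1 \<noteq> x"
    using nb_walk_of_nb_ends[OF z(1)] by metis
  obtain q where q: "nb_walk E k q" "q 0 = x''" "q k = z" "k > 0 \<longrightarrow> q 1 \<noteq> x"
    using nb_walk_of_nb_ends[OF z(2)] by metis
  \<comment> \<open>Positions \<open>0\<close> to \<open>k\<close> follow \<open>p\<close> backwards
    from \<open>z\<close> to \<open>x'\<close>, position \<open>Suc k\<close> is \<open>x\<close>,
    and the remaining ones follow \<open>q\<close> from \<open>x''\<close> to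
    \<open>z\<close>.\<close>
  define c where "c i = (if i \<le> k then p (k - i) else if i = Suc k then x else q (i - k - 2))" for i
  have "nb_walk E (2 * k + 2) c"
    unfolding nb_walk_def
  proof (intro conjI allI impI)
    fix i assume i: "i < 2 * k + 2"
    consider "i < k" | "i = k" | "i = Suc k" | "i > Suc k" by linarith
    then show "(c i, c (Suc i)) \<in> E"
    proof cases
      case 1
      then have "(p (k - Suc i), p (Suc (k - Suc i))) \<in> E" using p(1) by (auto simp: nb_walk_def)
      then show ?thesis using 1 sym_arcs by (auto simp: c_def Suc_diff_Suc dest: symD)
    next
      case 2
      then show ?thesis using p assms sym_arcs by (auto simp: c_def dest: symD)
    next
      case 3
      then show ?thesis using q assms by (auto simp: c_def)
    next
      case 4
      then have "(q (i - k - 2), q (Suc (i - k - 2))) \<in> E" using q(1) i by (auto simp: nb_walk_def)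
      then show ?thesis using 4 by (auto simp: c_def Suc_diff_le numeral_2_eq_2 Suc_diff_Suc)
    qed
  next
    fix i assume i: "i + 2 \<le> 2 * k + 2"
    \<comment> \<open>The three middle cases are the turns around \<open>x\<close>: they use
      \<open>p 1 \<noteq> x\<close>, then \<open>x' \<noteq> x''\<close>, then
      \<open>q 1 \<noteq> x\<close>. The outer two lie within \<open>p\<close> or
      \<open>q\<close>.\<close>
    consider "i + 2 \<le> k" | "i + 1 = k" | "i = k" | "i = Suc k" | "i > Suc k" by linarith
    then show "c i \<noteq> c (i + 2)"
    proof cases
      case 1
      then have "p (k - (i + 2)) \<noteq> p (k - (i + 2) + 2)" using p(1) by (auto simp: nb_walk_def)
      moreover have "k - (i + 2) + 2 = k - i" using 1 by simp
      ultimately show ?thesis using 1 by (auto simp: c_def)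
    next
      case 2
      then have "k - i = 1" "k > 0" by auto
      then show ?thesis using p 2 by (auto simp: c_def)
    next
      case 3
      then show ?thesis using p q assms by (auto simp: c_def)
    next
      case 4
      then have "i + 2 - k - 2 = 1" "k > 0" using i by auto
      then show ?thesis using q 4 by (auto simp: c_def)
    next
      case 5
      then have "q (i - k - 2) \<noteq> q (i - k - 2 + 2)" using q(1) i by (auto simp: nb_walk_def)
      moreover have "i - k - 2 + 2 = i + 2 - k - 2" using 5 by simp
      ultimately show ?thesis using 5 by (auto simp: c_def)
    qed
  qed
  moreover have "c 0 = c (2 * k + 2)" using p q by (auto simp: c_def)
  ultimately show False using nb_walk_not_closed[of "2 * k + 2" c] assms by auto
qed

text \<open>The union in the recursion is disjoint, so a sum over endpoints is a sum over
  non-backtracking walks, each endpoint being reached by only one.\<close>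

lemma sum_nb_ends_Suc:
  fixes f :: "'a \<Rightarrow> real"
  assumes "k < l"
  shows "sum f (nb_ends E (Suc k) y x) = (\<Sum>x'\<in>E `` {x} - {y}. sum f (nb_ends E k x x'))"
  unfolding nb_ends.simps
  by (rule sum.UNION_disjoint) (use finite_nbh finite_nb_ends nb_ends_disjoint[OF assms] in auto)

text \<open>The power sums \<open>f\<close> over the ends of all walks of length \<open>k\<close>.
  One more step multiplies the old error by at most \<open>\<Delta>\<close> and adds the walks
  through the forbidden vertex \<open>y\<close>, worth at most \<open>\<Delta> ^ k\<close>; this
  produces the factor \<open>k\<close>.\<close>

lemma adj_power_approx:
  assumes "deg_le \<Delta>" "\<And>x. \<bar>f x\<bar> \<le> 1" "k \<le> l"
  shows "\<bar>(adj E ^^ k) f x - sum f (nb_ends E k y x)\<bar> \<le> real k * \<Delta> ^ (k - 1)"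
  using \<open>k \<le> l\<close>
proof (induction k arbitrary: x y)
  case (Suc k)
  have \<Delta>: "\<Delta> \<ge> 0" using assms by (simp add: deg_le_def)
  define g where "g x' = (adj E ^^ k) f x' - sum f (nb_ends E k x x')" for x'
  have g: "\<bar>g x'\<bar> \<le> real k * \<Delta> ^ (k - 1)" for x' using Suc unfolding g_def by auto
  have split: "(adj E ^^ Suc k) f x = (\<Sum>x'\<in>E `` {x} - {y}. (adj E ^^ k) f x')
      + (if y \<in> E `` {x} then (adj E ^^ k) f y else 0)"
    using finite_nbh[of "{x}"] by (auto simp: adj_def sum.remove[where x = y])
  have "(adj E ^^ Suc k) f x - sum f (nb_ends E (Suc k) y x)
    = sum g (E `` {x} - {y}) + (if y \<in> E `` {x} then (adj E ^^ k) f y else 0)"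
    unfolding split using sum_nb_ends_Suc[of k f y x] Suc.prems
    by (simp add: g_def sum_subtractf del: nb_ends.simps)
  also have "\<bar>\<dots>\<bar> \<le> \<bar>sum g (E `` {x} - {y})\<bar> + \<Delta> ^ k"
    using abs_adj_power_le[where f = f and k = k and x = y, OF assms(1,2)] \<Delta> by auto
  also have "\<bar>sum g (E `` {x} - {y})\<bar> \<le> real (card (E `` {x} - {y})) * (real k * \<Delta> ^ (k - 1))"
    using sum_bounded_above[of "E `` {x} - {y}" "\<lambda>x. \<bar>g x\<bar>"] g
    by (intro order_trans[OF sum_abs]) auto
  also have "\<dots> \<le> \<Delta> * (real k * \<Delta> ^ (k - 1))"
  proof (rule mult_right_mono)
    have "card (E `` {x} - {y}) \<le> card (E `` {x})" by (intro card_mono finite_nbh) auto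
    then show "real (card (E `` {x} - {y})) \<le> \<Delta>"
      using assms(1) unfolding deg_le_def by (meson of_nat_le_iff order_trans)
  qed (use \<Delta> in simp)
  \<comment> \<open>At \<open>k = 0\<close> the exponent \<open>k - 1\<close> is truncated to 0, but
    the factor \<open>real k\<close> makes both sides vanish.\<close>
  also have "\<Delta> * (real k * \<Delta> ^ (k - 1)) = real k * \<Delta> ^ k"
    by (cases k) auto
  finally show ?case by (simp add: algebra_simps)
qed simp

text \<open>At every step at least \<open>c - 1\<close> neighbours remain after excluding
  \<open>y\<close>, and different choices lead to disjoint sets of endpoints. The neighbours reached
  are again non-isolated by symmetry.\<close>

lemma card_nb_ends_ge:
  assumes min: "\<And>x. E `` {x} \<noteq> {} \<Longrightarrow> c \<le> real (card (E `` {x}))" and c: "c \<ge> 1"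
  shows "k \<le> l \<Longrightarrow> E `` {x} \<noteq> {} \<Longrightarrow> (c - 1) ^ k \<le> real (card (nb_ends E k y x))"
proof (induction k arbitrary: x y)
  case (Suc k)
  have "(c - 1) ^ Suc k \<le> real (card (E `` {x} - {y})) * (c - 1) ^ k"
  proof -
    have "card (E `` {x}) \<le> card (E `` {x} - {y}) + 1"
      using finite_nbh[of "{x}"] by (simp add: card_Diff_singleton_if) linarith
    then have "c - 1 \<le> real (card (E `` {x} - {y}))" using min[OF Suc.prems(2)] by linarith
    then show ?thesis using c by (auto intro: mult_right_mono)
  qed
  also have "\<dots> \<le> (\<Sum>x'\<in>E `` {x} - {y}. real (card (nb_ends E k x x')))"
    using sum_bounded_below[of "E `` {x} - {y}" "(c - 1) ^ k" "\<lambda>x'. real (card (nb_ends E k x x'))"]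
      Suc sym_arcs by (auto dest: symD)
  also have "\<dots> = real (card (nb_ends E (Suc k) y x))"
    using sum_nb_ends_Suc[of k "\<lambda>_. 1" y x] Suc.prems by simp
  finally show ?case .
qed simp

text \<open>Each neighbour of \<open>x\<close> starts at least \<open>(c - 1) ^ (l - 1)\<close>
  walks that do not turn back to \<open>x\<close>, and all their endpoints differ, so the number of
  vertices limits the degree.\<close>

lemma max_degree_le:
  assumes min: "\<And>x. E `` {x} \<noteq> {} \<Longrightarrow> c \<le> real (card (E `` {x}))" and c: "c \<ge> 1" and l: "l \<ge> 1"
  shows "real (card (E `` {x})) * (c - 1) ^ (l - 1) \<le> real (card (X \<union> Y))"
proof -
  obtain k where k: "l = Suc k" using l by (cases l) auto
  \<comment> \<open>There are no loops, so taking \<open>x\<close> itself as the forbidden vertex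
    leaves all first steps allowed.\<close>
  have not: "x \<notin> E `` {x}" using arcs_subset disjoint by auto
  have "real (card (E `` {x})) * (c - 1) ^ k \<le> (\<Sum>x'\<in>E `` {x}. real (card (nb_ends E k x x')))"
  proof (rule sum_bounded_below)
    fix x' assume "x' \<in> E `` {x}"
    then have "E `` {x'} \<noteq> {}" using sym_arcs by (auto dest: symD)
    then show "(c - 1) ^ k \<le> real (card (nb_ends E k x x'))"
      using card_nb_ends_ge[OF min c] k by auto
  qed
  also have "\<dots> = real (card (nb_ends E l x x))"
    using sum_nb_ends_Suc[of k "\<lambda>_. 1" x x] k not by simp
  also have "nb_ends E l x x \<subseteq> X \<union> Y"
  proof -
    have "nb_ends E k y x \<subseteq> insert x (X \<union> Y)" for k y x
      using arcs_subset by (induction k arbitrary: y x) fastforce+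
    then have "nb_ends E k x x' \<subseteq> X \<union> Y" if "x' \<in> E `` {x}" for x'
      using that arcs_subset by fastforce
    then show ?thesis unfolding k by auto
  qed
  then have "real (card (nb_ends E l x x)) \<le> real (card (X \<union> Y))"
    using finite_X finite_Y by (intro of_nat_mono card_mono) auto
  finally show ?thesis using k by simp
qed

end

section \<open>Edge counts and centred indicators\<close>

context bipartite_arcs
begin

definition edges :: "'a set \<Rightarrow> 'a set \<Rightarrow> real" where
  "edges S T = real (card (E \<inter> S \<times> T))"

lemma finite_arcs: "finite E"
  by (rule finite_subset[OF arcs_subset]) (use finite_X finite_Y in auto)

lemma edges_commute: "edges S T = edges T S"
proof -
  have "E \<inter> T \<times> S = prod.swap ` (E \<inter> S \<times> T)"
    using sym_arcs by (force dest: symD)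
  then show ?thesis unfolding edges_def by (simp add: card_image)
qed

lemma sum_adj_indicator:
  assumes "finite T"
  shows "(\<Sum>t\<in>T. adj E (indicator S) t) = edges S T"
proof -
  have "(\<Sum>t\<in>T. adj E (indicator S) t) = (\<Sum>t\<in>T. real (card (E `` {t} \<inter> S)))"
    using finite_nbh by (simp add: adj_def indicator_def sum.If_cases Int_def)
  also have "\<dots> = real (card (Sigma T (\<lambda>t. E `` {t} \<inter> S)))"
    using assms finite_nbh by (subst card_SigmaI) auto
  also have "Sigma T (\<lambda>t. E `` {t} \<inter> S) = E \<inter> T \<times> S" by auto
  finally show ?thesis using edges_commute[of T S] by (simp add: edges_def)
qed

lemma nsq_indicator: "nsq (indicator X) = real (card X)"
proof -
  have "nsq (indicator X) = (\<Sum>x\<in>X. (indicator X x)\<^sup>2)"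
    unfolding nsq_def using finite_X finite_Y by (intro sum.mono_neutral_right) auto
  then show ?thesis by simp
qed

lemma sum_adj_square_le:
  assumes "T \<subseteq> Y"
  shows "(\<Sum>t\<in>T. adj E f t)\<^sup>2 \<le> real (card T) * nsq (adj E f)"
proof -
  have "(\<Sum>t\<in>T. adj E f t)\<^sup>2 \<le> (\<Sum>t\<in>T. (adj E f t)\<^sup>2) * real (card T)"
    by (rule sum_squared_le_sum_of_squares)
  also have "(\<Sum>t\<in>T. (adj E f t)\<^sup>2) \<le> nsq (adj E f)"
    unfolding nsq_def using assms finite_X finite_Y by (intro sum_mono2) auto
  finally show ?thesis by (simp add: mult.commute mult_right_mono)
qed

text \<open>Cauchy-Schwarz on \<open>Y\<close> bounds the edge count by the energy after one step,
  and log-convexity passes on to \<open>l\<close> steps.\<close>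

lemma edges_power_le:
  assumes "l \<ge> 1"
  shows "edges X Y ^ (2 * l)
    \<le> real (card Y) ^ l * real (card X) ^ (l - 1) * nsq ((adj E ^^ l) (indicator X))"
proof -
  have "edges X Y ^ 2 \<le> real (card Y) * nsq (adj E (indicator X))"
    using sum_adj_square_le[of Y "indicator X"] sum_adj_indicator[OF finite_Y, of X] by simp
  then have "edges X Y ^ (2 * l) \<le> real (card Y) ^ l * nsq (adj E (indicator X)) ^ l"
    using power_mono[of "edges X Y ^ 2" "real (card Y) * nsq (adj E (indicator X))" l]
    by (simp add: power_mult power_mult_distrib)
  also have "\<dots> \<le> real (card Y) ^ l *
      (nsq ((adj E ^^ l) (indicator X)) * real (card X) ^ (l - 1))"
    using nsq_adj_power_le[OF assms, of "indicator X"] nsq_indicator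
    by (intro mult_left_mono) auto
  finally show ?thesis by (simp add: mult_ac)
qed

lemma nsq_adj_power_eq:
  assumes "\<And>x. x \<notin> X \<Longrightarrow> f x = 0"
  shows "nsq ((adj E ^^ k) f) = (\<Sum>z\<in>(if even k then X else Y). ((adj E ^^ k) f z)\<^sup>2)"
  unfolding nsq_def using finite_X finite_Y adj_power_parity[of f _ k] assms
  by (intro sum.mono_neutral_right) auto

lemma adj_power_nonneg: "(\<And>x. f x \<ge> 0) \<Longrightarrow> (adj E ^^ k) f x \<ge> 0"
  by (induction k arbitrary: x) (auto simp: adj_def sum_nonneg)

text \<open>The indicator of \<open>S\<close> minus its mean over \<open>X\<close>; for
  \<open>S \<subseteq> X\<close> it sums to zero and vanishes off \<open>X\<close>. For empty
  \<open>X\<close> the quotient is 0.\<close>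

definition centred :: "'a set \<Rightarrow> 'a \<Rightarrow> real" where
  "centred S x = indicator S x - real (card S) / real (card X) * indicator X x"

lemma centred_outside: "S \<subseteq> X \<Longrightarrow> x \<notin> X \<Longrightarrow> centred S x = 0"
  by (auto simp: centred_def indicator_def)

lemma abs_centred_le: "S \<subseteq> X \<Longrightarrow> \<bar>centred S x\<bar> \<le> 1"
proof -
  assume "S \<subseteq> X"
  then have "card S \<le> card X" using finite_X by (rule card_mono[rotated])
  then have "real (card S) / real (card X) \<le> 1" "0 \<le> real (card S) / real (card X)"
    by (auto simp: divide_le_eq_1)
  then show ?thesis
    using \<open>S \<subseteq> X\<close> by (auto simp: centred_def indicator_def)
qed

lemma sum_centred:
  assumes "S \<subseteq> X"
  shows "sum (centred S) X = 0"
proof (cases "X = {}")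
  case False
  have "sum (indicator S) X = real (card S)"
    using assms finite_X by (simp add: indicator_def sum.If_cases Int_absorb1)
  then show ?thesis
    using False finite_X by (simp add: centred_def sum_subtractf flip: sum_distrib_left)
qed simp

lemma nsq_centred_le:
  assumes "S \<subseteq> X"
  shows "nsq (centred S) \<le> real (card X)"
proof -
  have "nsq (centred S) = (\<Sum>x\<in>X. (centred S x)\<^sup>2)"
    using nsq_adj_power_eq[of "centred S" 0] centred_outside[OF assms] by simp
  also have "\<dots> \<le> (\<Sum>x\<in>X. 1)"
    using abs_centred_le[OF assms] by (intro sum_mono) (simp add: abs_square_le_1)
  finally show ?thesis by simp
qed

text \<open>Summing \<open>adj E (centred S)\<close> over \<open>T\<close> gives exactly the
  deviation on the left, since the mean part contributes a multiple of \<open>edges X T\<close>.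
  Cauchy-Schwarz does the rest.\<close>

lemma discrepancy_square_le:
  assumes "S \<subseteq> X" "T \<subseteq> Y"
  shows "(edges S T - real (card S) / real (card X) * edges X T)\<^sup>2
    \<le> real (card T) * nsq (adj E (centred S))"
proof -
  have "finite T" using assms finite_Y by (metis finite_subset)
  have "(\<Sum>t\<in>T. adj E (centred S) t) = edges S T - real (card S) / real (card X) * edges X T"
    unfolding centred_def[abs_def] adj_diff adj_scale sum_subtractf
    by (simp add: sum_adj_indicator[OF \<open>finite T\<close>]
        flip: sum_distrib_left sum_divide_distrib)
  then show ?thesis using sum_adj_square_le[OF assms(2), of "centred S"] by simp
qed

end

section \<open>Energy of the \<open>l\<close>-th power under large girth\<close>

context bipartite_girth
begin

text \<open>By the parity of \<open>l\<close>, walks of length \<open>l\<close> that end in \<open>X\<close> start in this part.\<close>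

definition Z :: "'a set" where
  "Z = (if even l then X else Y)"

text \<open>Walks of length \<open>l\<close> from \<open>Z\<close> end in \<open>X\<close>, so
  summing \<open>indicator X\<close> over the endpoints merely counts them, and there are at most
  \<open>card X\<close>.\<close>

lemma adj_power_indicator_le:
  assumes "deg_le \<Delta>" "z \<in> Z"
  shows "\<bar>(adj E ^^ l) (indicator X) z - real (card (nb_ends E l z z))\<bar> \<le> real l * \<Delta> ^ (l - 1)"
    and "(adj E ^^ l) (indicator X) z \<le> real (card X) + real l * \<Delta> ^ (l - 1)"
proof -
  have sub: "nb_ends E l z z \<subseteq> X" using nb_ends_parity assms unfolding Z_def by blast
  then have "sum (indicator X) (nb_ends E l z z) = real (card (nb_ends E l z z))"
    using finite_nb_ends by (simp add: indicator_def sum.If_cases Int_absorb2)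
  then show 1: "\<bar>(adj E ^^ l) (indicator X) z - real (card (nb_ends E l z z))\<bar>
      \<le> real l * \<Delta> ^ (l - 1)"
    using adj_power_approx[OF assms(1), of "indicator X" l z z] by (simp add: indicator_def)
  have "card (nb_ends E l z z) \<le> card X" using sub finite_X by (rule card_mono[rotated])
  then show "(adj E ^^ l) (indicator X) z \<le> real (card X) + real l * \<Delta> ^ (l - 1)"
    using 1 by linarith
qed

lemma nsq_adj_power_indicator_le:
  assumes "deg_le \<Delta>"
  shows "nsq ((adj E ^^ l) (indicator X))
    \<le> real (card Z) * (real (card X) + real l * \<Delta> ^ (l - 1))\<^sup>2"
proof -
  have "nsq ((adj E ^^ l) (indicator X)) = (\<Sum>z\<in>Z. ((adj E ^^ l) (indicator X) z)\<^sup>2)"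
    using nsq_adj_power_eq[of "indicator X" l] unfolding Z_def by simp
  also have "\<dots> \<le> (\<Sum>z\<in>Z. (real (card X) + real l * \<Delta> ^ (l - 1))\<^sup>2)"
    using adj_power_indicator_le(2)[OF assms] adj_power_nonneg[of "indicator X" l]
    by (intro sum_mono power_mono) auto
  finally show ?thesis by simp
qed

text \<open>
  A non-backtracking walk from \<open>z\<close> misses few vertices of \<open>X\<close>, and a function of sum zero
  has the same sum, up to sign, over the missed vertices as over the endpoints.
\<close>

lemma abs_adj_power_centred_le:
  assumes "deg_le \<Delta>" "z \<in> Z" "S \<subseteq> X"
  defines "\<eta> \<equiv> real l * \<Delta> ^ (l - 1)"
  shows "\<bar>(adj E ^^ l) (centred S) z\<bar> \<le> real (card X) + \<eta>"
    and "\<bar>(adj E ^^ l) (centred S) z\<bar> \<le> real (card X) + 2 * \<eta> - (adj E ^^ l) (indicator X) z"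
proof -
  define R where "R = nb_ends E l z z"
  have sub: "R \<subseteq> X" using nb_ends_parity assms(2) unfolding Z_def R_def by blast
  have "sum (centred S) R = - sum (centred S) (X - R)"
    using sum_centred[OF assms(3)] sum.subset_diff[OF sub finite_X, of "centred S"] by simp
  also have "\<bar>\<dots>\<bar> \<le> (\<Sum>x\<in>X - R. 1)"
    unfolding abs_minus
    using abs_centred_le[OF assms(3)] by (intro order_trans[OF sum_abs] sum_mono) auto
  also have "\<dots> = real (card X) - real (card R)"
    using sub finite_X by (simp add: card_Diff_subset finite_subset of_nat_diff card_mono)
  finally have *: "\<bar>sum (centred S) R\<bar> \<le> real (card X) - real (card R)" .
  have **: "\<bar>(adj E ^^ l) (centred S) z - sum (centred S) R\<bar> \<le> \<eta>"
    unfolding R_def \<eta>_def using assms abs_centred_le by (intro adj_power_approx) auto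
  show "\<bar>(adj E ^^ l) (centred S) z\<bar> \<le> real (card X) + \<eta>"
    using * ** by linarith
  show "\<bar>(adj E ^^ l) (centred S) z\<bar> \<le> real (card X) + 2 * \<eta> - (adj E ^^ l) (indicator X) z"
    using * ** adj_power_indicator_le(1)[OF assms(1,2)] unfolding R_def \<eta>_def by linarith
qed

text \<open>At each \<open>z\<close> the two bounds \<open>?a\<close> and \<open>?b - ?w\<close> for
  the centred power are multiplied. As \<open>?w \<le> ?a\<close>, the product is at most
  \<open>?a * ?b - ?w\<^sup>2\<close>, and the squares of \<open>?w\<close> sum to the energy that
  \<open>edges_power_le\<close> bounds from below.\<close>

lemma nsq_adj_power_centred_le:
  assumes "deg_le \<Delta>" "S \<subseteq> X"
  defines "\<eta> \<equiv> real l * \<Delta> ^ (l - 1)"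
  shows "nsq ((adj E ^^ l) (centred S))
    \<le> real (card Z) * (real (card X) + \<eta>) * (real (card X) + 2 * \<eta>)
      - nsq ((adj E ^^ l) (indicator X))"
proof -
  have eta: "\<eta> \<ge> 0" using assms(1) by (simp add: \<eta>_def deg_le_def)
  have "((adj E ^^ l) (centred S) z)\<^sup>2
    \<le> (real (card X) + \<eta>) * (real (card X) + 2 * \<eta>) - ((adj E ^^ l) (indicator X) z)\<^sup>2"
    (is "?u\<^sup>2 \<le> ?a * ?b - ?w\<^sup>2") if z: "z \<in> Z" for z
  proof -
    have "?u\<^sup>2 = \<bar>?u\<bar> * \<bar>?u\<bar>" by (simp add: power2_eq_square)
    also have "\<dots> \<le> ?a * (?b - ?w)"
      using abs_adj_power_centred_le[OF assms(1) z assms(2)] eta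
      by (intro mult_mono) (auto simp: \<eta>_def)
    also have "?w * ?w \<le> ?a * ?w"
      using adj_power_indicator_le(2)[OF assms(1) z] adj_power_nonneg[of "indicator X" l z]
      by (intro mult_right_mono) (auto simp: \<eta>_def)
    then have "?a * (?b - ?w) \<le> ?a * ?b - ?w\<^sup>2" by (simp add: algebra_simps power2_eq_square)
    finally show ?thesis .
  qed
  then have "(\<Sum>z\<in>Z. ((adj E ^^ l) (centred S) z)\<^sup>2)
    \<le> (\<Sum>z\<in>Z. (real (card X) + \<eta>) * (real (card X) + 2 * \<eta>) - ((adj E ^^ l) (indicator X) z)\<^sup>2)"
    by (rule sum_mono)
  then show ?thesis
    using nsq_adj_power_eq[of "indicator X" l]
      nsq_adj_power_eq[of "centred S" l] centred_outside[OF assms(2)]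
    by (simp add: sum_subtractf Z_def split del: if_split)
qed

text \<open>The energy bounds obtained from both parts are multiplied and a square root is taken.
  The two start parts have sizes with product \<open>card X * card Y\<close> whatever the parity of
  \<open>l\<close>, so the result is symmetric.\<close>

lemma edges_power_part_sizes_le:
  assumes "deg_le \<Delta>" "l \<ge> 1"
  defines "\<eta> \<equiv> real l * \<Delta> ^ (l - 1)"
  shows "edges X Y ^ (2 * l)
    \<le> (real (card X) * real (card Y)) ^ l * ((real (card X) + \<eta>) * (real (card Y) + \<eta>))"
proof (rule power2_le_imp_le)
  interpret s: bipartite_girth Y X E l by (rule swap_girth)
  define a where "a = real (card X)"
  define b where "b = real (card Y)"
  have eta: "\<eta> \<ge> 0" using assms(1) by (simp add: \<eta>_def deg_le_def)
  have 1: "edges X Y ^ (2 * l) \<le> b ^ l * a ^ (l - 1) * (real (card Z) * (a + \<eta>)\<^sup>2)"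
    using order_trans[OF edges_power_le[OF assms(2)] mult_left_mono[OF nsq_adj_power_indicator_le[OF assms(1)]]]
    by (simp add: a_def b_def \<eta>_def)
  have 2: "edges X Y ^ (2 * l) \<le> a ^ l * b ^ (l - 1) * (real (card s.Z) * (b + \<eta>)\<^sup>2)"
    using order_trans[OF s.edges_power_le[OF assms(2)] mult_left_mono[OF s.nsq_adj_power_indicator_le[OF assms(1)]]]

    by (simp add: a_def b_def \<eta>_def edges_commute[of Y X])
  have Z: "real (card Z) * real (card s.Z) = a * b"
    unfolding Z_def s.Z_def a_def b_def by simp
  have "(edges X Y ^ (2 * l))\<^sup>2 \<le> (b ^ l * a ^ (l - 1) * (real (card Z) * (a + \<eta>)\<^sup>2))
      * (a ^ l * b ^ (l - 1) * (real (card s.Z) * (b + \<eta>)\<^sup>2))"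
    unfolding power2_eq_square[of "edges X Y ^ (2 * l)"]
    by (rule mult_mono[OF 1 2]) (auto simp: a_def b_def edges_def)
  also have "\<dots> = (b ^ l * a ^ (l - 1) * (a ^ l * b ^ (l - 1))
      * (real (card Z) * real (card s.Z))) * ((a + \<eta>)\<^sup>2 * (b + \<eta>)\<^sup>2)"
    by (simp add: mult_ac)
  also have "b ^ l * a ^ (l - 1) * (a ^ l * b ^ (l - 1)) * (real (card Z) * real (card s.Z))
      = ((a * b) ^ l)\<^sup>2"
    unfolding Z using assms(2) by (cases l) (auto simp: power_mult_distrib power2_eq_square)
  finally show "(edges X Y ^ (2 * l))\<^sup>2 \<le> ((real (card X) * real (card Y)) ^ l
      * ((real (card X) + \<eta>) * (real (card Y) + \<eta>)))\<^sup>2"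
    by (simp add: power_mult_distrib a_def b_def)
  show "0 \<le> (real (card X) * real (card Y)) ^ l * ((real (card X) + \<eta>) * (real (card Y) + \<eta>))"
    using eta by simp
qed

end

section \<open>Numerical consequences of a nearly extremal edge count\<close>

text \<open>Put \<open>p = a * b / M\<^sup>2\<close>, which is at most 1 as \<open>a\<close> and
  \<open>b\<close> have mean \<open>M\<close>. Then \<open>p ^ l \<le> p\<close> reduces the
  hypothesis to \<open>1 - \<tau>\<^sup>2 / 2 \<le> p * (1 + \<tau>\<^sup>2 / 2)\<close>.\<close>

lemma part_sizes_balanced:
  fixes a b M \<eta> \<tau> :: real
  assumes ab: "a \<ge> 0" "b \<ge> 0" "a + b = 2 * M" and M: "M > 0" and l: "l \<ge> 1"
    and \<tau>: "0 < \<tau>" "\<tau> \<le> 1" and \<eta>: "0 \<le> \<eta>" "\<eta> \<le> \<tau>\<^sup>2 / 6 * M"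
    and le: "(1 - \<tau>\<^sup>2 / 2) * M ^ (2 * l + 2) \<le> (a * b) ^ l * ((a + \<eta>) * (b + \<eta>))"
  shows "(1 - \<tau>\<^sup>2) * M\<^sup>2 \<le> a * b" "a * b \<le> M\<^sup>2"
proof -
  \<comment> \<open>Since \<open>h \<le> 1\<close>, the square of \<open>1 + h\<close> is at most
    \<open>1 + 3 * h\<close>, that is \<open>1 + \<tau>\<^sup>2 / 2\<close>.\<close>
  define h where "h = \<tau>\<^sup>2 / 6"
  have \<tau>2: "\<tau>\<^sup>2 \<le> 1" using \<tau> by (simp add: power_le_one)
  then have h: "0 \<le> h" "h \<le> 1" by (auto simp: h_def)
  have ab_le: "a * b \<le> M\<^sup>2"
  proof -
    have b: "b = 2 * M - a" using ab by simp
    have "0 \<le> (a - M)\<^sup>2" by simp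
    then show ?thesis unfolding b by (simp add: power2_eq_square algebra_simps)
  qed
  then show "a * b \<le> M\<^sup>2" .
  define p where "p = a * b / M\<^sup>2"
  have p: "0 \<le> p" "p \<le> 1" "a * b = p * M\<^sup>2" using ab M ab_le by (auto simp: p_def)
  have "(a + \<eta>) * (b + \<eta>) = a * b + (a + b) * \<eta> + \<eta>\<^sup>2"
    by (simp add: algebra_simps power2_eq_square)
  also have "\<dots> = a * b + 2 * M * \<eta> + \<eta>\<^sup>2" unfolding ab(3) ..
  also have "\<dots> \<le> M\<^sup>2 + 2 * M * (h * M) + (h * M)\<^sup>2"
    using ab_le \<eta> M by (intro add_mono mult_left_mono power_mono) (auto simp: h_def)
  also have "\<dots> = (1 + 2 * h + h * h) * M\<^sup>2" by (simp add: algebra_simps power2_eq_square)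
  also have "\<dots> \<le> (1 + 3 * h) * M\<^sup>2"
    using h mult_left_mono[of h 1 h] by (intro mult_right_mono) auto
  finally have 1: "(a + \<eta>) * (b + \<eta>) \<le> (1 + \<tau>\<^sup>2 / 2) * M\<^sup>2" by (simp add: h_def)
  have "p ^ l \<le> p" using p l power_decreasing[of 1 l p] by simp
  then have 2: "(a * b) ^ l \<le> p * M ^ (2 * l)"
    unfolding p(3) power_mult_distrib power_mult[symmetric] using M by (intro mult_right_mono) auto
  have "(1 - \<tau>\<^sup>2 / 2) * M ^ (2 * l + 2) \<le> (p * M ^ (2 * l)) * ((1 + \<tau>\<^sup>2 / 2) * M\<^sup>2)"
    by (rule order_trans[OF le], rule mult_mono[OF 2 1]) (use ab \<eta> M p in auto)
  then have "(1 - \<tau>\<^sup>2 / 2) * M ^ (2 * l + 2) \<le> (p * (1 + \<tau>\<^sup>2 / 2)) * M ^ (2 * l + 2)"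
    by (simp add: power_add power2_eq_square mult_ac)
  then have "1 - \<tau>\<^sup>2 / 2 \<le> p * (1 + \<tau>\<^sup>2 / 2)" using M by simp
  also have "\<dots> \<le> p + \<tau>\<^sup>2 / 2" using p mult_right_mono[of p 1 "\<tau>\<^sup>2 / 2"] by (simp add: algebra_simps)
  finally have "1 - \<tau>\<^sup>2 \<le> p" by simp
  then show "(1 - \<tau>\<^sup>2) * M\<^sup>2 \<le> a * b" unfolding p(3) by (rule mult_right_mono) simp
qed

text \<open>Here \<open>s\<close> stands for the energy of the \<open>l\<close>-th power of
  \<open>indicator X\<close> and \<open>z\<close> for the size of the start part. Balance puts both
  parts within \<open>\<tau> * M\<close> of \<open>M\<close>, so the product is at most
  \<open>(1 + 23 * \<tau>) * M ^ 3\<close> while \<open>s\<close> is at least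
  \<open>(1 - \<tau>) * M ^ 3\<close>.\<close>

lemma energy_excess_le:
  fixes a b z M \<eta> \<tau> s :: real
  assumes ab: "a \<ge> 0" "b \<ge> 0" "a + b = 2 * M" and M: "M > 0" and l: "l \<ge> 1"
    and \<tau>: "0 < \<tau>" "\<tau> \<le> 1" and \<eta>: "0 \<le> \<eta>" "\<eta> \<le> \<tau> * M"
    and bal: "(1 - \<tau>\<^sup>2) * M\<^sup>2 \<le> a * b" "a * b \<le> M\<^sup>2" and z: "z = a \<or> z = b"
    and s: "s \<ge> 0" "(1 - \<tau>\<^sup>2) * M ^ (2 * l + 2) \<le> b ^ l * a ^ (l - 1) * s"
  shows "z * (a + \<eta>) * (a + 2 * \<eta>) - s \<le> 24 * \<tau> * M ^ 3"
proof -
  have sq: "(a - M)\<^sup>2 \<le> (\<tau> * M)\<^sup>2"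
  proof -
    have b: "b = 2 * M - a" using ab by simp
    have "(a - M)\<^sup>2 = M\<^sup>2 - a * b" unfolding b by (simp add: power2_eq_square algebra_simps)
    then show ?thesis using bal(1) by (simp add: algebra_simps power_mult_distrib)
  qed
  then have "\<bar>a - M\<bar> \<le> \<tau> * M" using \<tau> M by (simp add: power2_le_iff_abs_le)
  then have a: "a \<le> (1 + \<tau>) * M" and b: "b \<le> (1 + \<tau>) * M" using ab by (auto simp: algebra_simps)
  obtain k where k: "l = Suc k" using l by (cases l) auto
  have "b ^ l * a ^ (l - 1) = b * (a * b) ^ k" unfolding k by (simp add: power_mult_distrib)
  also have "\<dots> \<le> ((1 + \<tau>) * M) * (M\<^sup>2) ^ k"
    using b ab bal \<tau> M by (intro mult_mono power_mono) auto
  finally have "b ^ l * a ^ (l - 1) \<le> (1 + \<tau>) * M ^ (2 * k + 1)"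
    by (simp add: mult_ac flip: power_mult)
  then have "(1 - \<tau>\<^sup>2) * M ^ (2 * l + 2) \<le> (1 + \<tau>) * M ^ (2 * k + 1) * s"
    using s by (meson mult_right_mono order_trans)
  then have "((1 - \<tau>\<^sup>2) * M ^ 3) * M ^ (2 * k + 1) \<le> ((1 + \<tau>) * s) * M ^ (2 * k + 1)"
    unfolding k by (simp add: power_add power3_eq_cube power2_eq_square mult_ac)
  then have "(1 - \<tau>\<^sup>2) * M ^ 3 \<le> (1 + \<tau>) * s" using M by (simp del: power_Suc power_add)
  then have "(1 + \<tau>) * ((1 - \<tau>) * M ^ 3) \<le> (1 + \<tau>) * s"
    by (simp add: algebra_simps power2_eq_square)
  then have s': "(1 - \<tau>) * M ^ 3 \<le> s" using \<tau> by simp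
  have "z * (a + \<eta>) * (a + 2 * \<eta>) \<le> ((1 + \<tau>) * M) * ((1 + 2 * \<tau>) * M) * ((1 + 3 * \<tau>) * M)"
    using a b z \<eta> ab \<tau> M by (intro mult_mono) (auto simp: algebra_simps)
  also have "\<dots> = (1 + 6 * \<tau> + 11 * \<tau> * \<tau> + 6 * \<tau> * \<tau> * \<tau>) * M ^ 3"
    by (simp add: algebra_simps power3_eq_cube)
  \<comment> \<open>As \<open>\<tau> \<le> 1\<close>, its higher powers are replaced by
    \<open>\<tau>\<close>, and 6 + 11 + 6 = 23.\<close>
  also have "\<dots> \<le> (1 + 23 * \<tau>) * M ^ 3"
  proof (rule mult_right_mono)
    have "\<tau> * \<tau> \<le> \<tau>" using \<tau> mult_left_mono[of \<tau> 1 \<tau>] by simp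
    moreover from this have "\<tau> * \<tau> * \<tau> \<le> \<tau>" using \<tau> mult_right_mono[of "\<tau> * \<tau>" \<tau> \<tau>] by linarith
    ultimately show "1 + 6 * \<tau> + 11 * \<tau> * \<tau> + 6 * \<tau> * \<tau> * \<tau> \<le> 1 + 23 * \<tau>" by linarith
  qed (use M in simp)
  finally show ?thesis using s' by (simp add: algebra_simps)
qed

section \<open>Discrepancy under a maximum degree bound\<close>

context bipartite_girth
begin

text \<open>A nearly extremal edge count leaves energy at most \<open>24 * \<tau> * M ^ 3\<close>
  for the \<open>l\<close>-th power of \<open>centred S\<close>, which log-convexity and
  Cauchy-Schwarz turn into a discrepancy bound. Only \<open>S\<close> is averaged out here;
  \<open>T\<close> remains in the comparison term \<open>edges X T\<close>.\<close>

lemma one_sided_discrepancy_le: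
  assumes deg: "deg_le \<Delta>" and l: "l \<ge> 1" and ST: "S \<subseteq> X" "T \<subseteq> Y"
    and M: "M > 0" "real (card X) + real (card Y) = 2 * M" and D: "D > 0" "D ^ l = M"
    and \<tau>: "0 < \<tau>" "\<tau> \<le> 1" and \<eta>: "real l * \<Delta> ^ (l - 1) \<le> \<tau>\<^sup>2 / 6 * M"
    and e: "(1 - \<tau>\<^sup>2 / 2) * M ^ (2 * l + 2) \<le> edges X Y ^ (2 * l)"
    and \<kappa>: "0 \<le> \<kappa>" "12 * 4 ^ l * \<tau> \<le> \<kappa> ^ (2 * l)"
  shows "\<bar>edges S T - real (card S) / real (card X) * edges X T\<bar> \<le> \<kappa> * (M * D)"
    and "(1 - \<tau>\<^sup>2) * M\<^sup>2 \<le> real (card X) * real (card Y)"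
    and "real (card X) * real (card Y) \<le> M\<^sup>2"
proof -
  define \<eta> where "\<eta> = real l * \<Delta> ^ (l - 1)"
  define a where "a = real (card X)"
  define b where "b = real (card Y)"
  define t where "t = \<bar>edges S T - real (card S) / real (card X) * edges X T\<bar>"
  have eta0: "\<eta> \<ge> 0" using deg by (simp add: \<eta>_def deg_le_def)
  have ab: "a \<ge> 0" "b \<ge> 0" "a + b = 2 * M" using M by (auto simp: a_def b_def)
  have le: "(1 - \<tau>\<^sup>2 / 2) * M ^ (2 * l + 2) \<le> (a * b) ^ l * ((a + \<eta>) * (b + \<eta>))"
    using order_trans[OF e edges_power_part_sizes_le[OF deg l]] by (simp add: a_def b_def \<eta>_def)
  have \<eta>': "\<eta> \<le> \<tau>\<^sup>2 / 6 * M" using \<eta> by (simp add: \<eta>_def)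
  note bal = part_sizes_balanced[OF ab M(1) l \<tau> eta0 \<eta>' le]
  then show "(1 - \<tau>\<^sup>2) * M\<^sup>2 \<le> real (card X) * real (card Y)"
    "real (card X) * real (card Y) \<le> M\<^sup>2" by (auto simp: a_def b_def)
  have "\<tau>\<^sup>2 / 6 * M \<le> \<tau> * M"
    using \<tau> M by (intro mult_right_mono) (auto simp: power2_eq_square divide_le_eq)
  with \<eta>' have \<eta>\<tau>: "\<eta> \<le> \<tau> * M" by simp
  define s where "s = nsq ((adj E ^^ l) (indicator X))"
  have "(1 - \<tau>\<^sup>2) * M ^ (2 * l + 2) \<le> (1 - \<tau>\<^sup>2 / 2) * M ^ (2 * l + 2)"
    using M by (intro mult_right_mono) auto
  also have "\<dots> \<le> b ^ l * a ^ (l - 1) * s"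
    using order_trans[OF e edges_power_le[OF l]] by (simp add: a_def b_def s_def)
  finally have s: "(1 - \<tau>\<^sup>2) * M ^ (2 * l + 2) \<le> b ^ l * a ^ (l - 1) * s" .
  have z: "real (card Z) = a \<or> real (card Z) = b" by (simp add: Z_def a_def b_def)
  have s0: "s \<ge> 0" by (simp add: s_def nsq_nonneg)
  have "nsq ((adj E ^^ l) (centred S)) \<le> real (card Z) * (a + \<eta>) * (a + 2 * \<eta>) - s"
    using nsq_adj_power_centred_le[OF deg ST(1)] by (simp add: a_def s_def \<eta>_def)
  also have "\<dots> \<le> 24 * \<tau> * M ^ 3"
    by (rule energy_excess_le[OF ab M(1) l \<tau> eta0 \<eta>\<tau> bal z s0 s])
  finally have nsq_l: "nsq ((adj E ^^ l) (centred S)) \<le> 24 * \<tau> * M ^ 3" .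
  have "nsq (adj E (centred S)) ^ l \<le> nsq ((adj E ^^ l) (centred S)) * nsq (centred S) ^ (l - 1)"
    by (rule nsq_adj_power_le[OF l])
  also have "\<dots> \<le> (24 * \<tau> * M ^ 3) * (2 * M) ^ (l - 1)"
    using nsq_l nsq_centred_le[OF ST(1)] nsq_nonneg ab \<tau> M
    by (intro mult_mono power_mono) (auto simp: a_def b_def)
  finally have nsq_1: "nsq (adj E (centred S)) ^ l \<le> (24 * \<tau> * M ^ 3) * (2 * M) ^ (l - 1)" .
  have "card T \<le> card Y" using ST finite_Y by (intro card_mono)
  then have T: "real (card T) \<le> 2 * M" using ab by (simp add: a_def b_def)
  have "t ^ (2 * l) = (t\<^sup>2) ^ l" by (simp add: power_mult)
  also have "\<dots> \<le> (real (card T) * nsq (adj E (centred S))) ^ l"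
    using discrepancy_square_le[OF ST] by (intro power_mono) (auto simp: t_def)
  also have "\<dots> \<le> (2 * M) ^ l * ((24 * \<tau> * M ^ 3) * (2 * M) ^ (l - 1))"
    unfolding power_mult_distrib[of "real (card T)"]
    using T nsq_1 nsq_nonneg M by (intro mult_mono power_mono) auto
  \<comment> \<open>The constant is \<open>24 * 2 ^ (2 * l - 1) = 12 * 4 ^ l\<close>, the powers of
    2 coming from the crude bound \<open>2 * M\<close> on the sizes of \<open>X\<close> and
    \<open>T\<close>.\<close>
  also have "\<dots> = (12 * 4 ^ l * \<tau>) * M ^ (2 * l + 2)"
  proof -
    obtain k where k: "l = Suc k" using l by (cases l) auto
    have "(2 * M) ^ k * (2 * M) ^ k = (2 * M * (2 * M)) ^ k"
      by (rule power_mult_distrib[symmetric])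
    also have "2 * M * (2 * M) = 4 * M\<^sup>2" by (simp add: power2_eq_square)
    also have "(4 * M\<^sup>2) ^ k = 4 ^ k * M ^ (2 * k)"
      by (simp only: power_mult_distrib power_mult)
    finally have sq: "(2 * M) ^ k * (2 * M) ^ k = 4 ^ k * M ^ (2 * k)" .
    have "2 * l + 2 = Suc (3 + 2 * k)" by (simp add: k)
    then have M4: "M ^ (2 * l + 2) = M * (M ^ 3 * M ^ (2 * k))" by (simp only: power_Suc power_add)
    have "(2 * M) ^ l * ((24 * \<tau> * M ^ 3) * (2 * M) ^ (l - 1))
      = 48 * \<tau> * (M * M ^ 3) * ((2 * M) ^ k * (2 * M) ^ k)"
      by (simp add: k)
    also have "\<dots> = (12 * 4 ^ l * \<tau>) * M ^ (2 * l + 2)"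
      unfolding sq M4 by (simp add: k)
    finally show ?thesis .
  qed
  also have "\<dots> \<le> \<kappa> ^ (2 * l) * M ^ (2 * l + 2)"
    using \<kappa> M by (intro mult_right_mono) auto
  \<comment> \<open>\<open>D ^ l = M\<close> accounts for the two extra factors \<open>M\<close>, so
    that a \<open>2 * l\<close>-th root can be taken.\<close>
  also have "M ^ (2 * l + 2) = (M * D) ^ (2 * l)"
  proof -
    have "(M * D) ^ (2 * l) = M ^ (2 * l) * (D ^ l)\<^sup>2"
      by (simp add: power_mult_distrib power_even_eq)
    then show ?thesis using D by (simp add: power_add power2_eq_square)
  qed
  also have "\<kappa> ^ (2 * l) * (M * D) ^ (2 * l) = (\<kappa> * (M * D)) ^ (2 * l)"
    by (simp add: power_mult_distrib)
  finally have "t ^ (2 * l) \<le> (\<kappa> * (M * D)) ^ (2 * l)" .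
  then show "\<bar>edges S T - real (card S) / real (card X) * edges X T\<bar> \<le> \<kappa> * (M * D)"
    unfolding t_def[symmetric] using \<kappa> M D l by (intro power_mono_iff[THEN iffD1, of t _ "2 * l"]) (auto simp: t_def)
qed

text \<open>The one-sided bound is used twice: first \<open>S\<close> is replaced by
  \<open>X\<close>, then, with the parts exchanged, \<open>T\<close> by \<open>Y\<close>. Replacing
  \<open>card X * card Y\<close> by \<open>M\<^sup>2\<close> costs the term with
  \<open>\<tau>\<^sup>2\<close>.\<close>

lemma discrepancy_le:
  assumes deg: "deg_le \<Delta>" and l: "l \<ge> 1" and ST: "S \<subseteq> X" "T \<subseteq> Y"
    and M: "M > 0" "real (card X) + real (card Y) = 2 * M" and D: "D > 0" "D ^ l = M"
    and \<tau>: "0 < \<tau>" "\<tau> \<le> 1" and \<eta>: "real l * \<Delta> ^ (l - 1) \<le> \<tau>\<^sup>2 / 6 * M"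
    and e: "(1 - \<tau>\<^sup>2 / 2) * M ^ (2 * l + 2) \<le> edges X Y ^ (2 * l)"
    and \<kappa>: "0 \<le> \<kappa>" "12 * 4 ^ l * \<tau> \<le> \<kappa> ^ (2 * l)"
  shows "\<bar>edges S T - real (card S) * real (card T) * edges X Y / M\<^sup>2\<bar>
    \<le> 2 * \<kappa> * (M * D) + \<tau>\<^sup>2 * edges X Y"
proof -
  interpret s: bipartite_girth Y X E l by (rule swap_girth)
  have 1: "\<bar>edges S T - real (card S) / real (card X) * edges X T\<bar> \<le> \<kappa> * (M * D)"
    and bal: "(1 - \<tau>\<^sup>2) * M\<^sup>2 \<le> real (card X) * real (card Y)" "real (card X) * real (card Y) \<le> M\<^sup>2"
    using one_sided_discrepancy_le[OF deg l ST M D \<tau> \<eta> e \<kappa>] by auto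
  have 2: "\<bar>edges X T - real (card T) / real (card Y) * edges X Y\<bar> \<le> \<kappa> * (M * D)"
    using s.one_sided_discrepancy_le(1)[OF deg l ST(2) order_refl M(1) _ D \<tau> \<eta> _ \<kappa>] M(2) e
    by (simp add: add.commute edges_commute[of Y X] edges_commute[of T X])
  define \<sigma> where "\<sigma> = real (card S) / real (card X)"
  define \<theta> where "\<theta> = real (card T) / real (card Y)"
  define q where "q = real (card X) * real (card Y) / M\<^sup>2"
  have q: "1 - \<tau>\<^sup>2 \<le> q" "q \<le> 1" using bal M by (auto simp: q_def divide_le_eq le_divide_eq)
  have "card S \<le> card X" "card T \<le> card Y" using ST finite_X finite_Y by (auto intro: card_mono)
  then have \<sigma>: "0 \<le> \<sigma>" "\<sigma> \<le> 1" and \<theta>: "0 \<le> \<theta>" "\<theta> \<le> 1"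
    by (auto simp: \<sigma>_def \<theta>_def divide_le_eq_1)
  have ST': "real (card S) = \<sigma> * real (card X)" "real (card T) = \<theta> * real (card Y)"
    using \<open>card S \<le> card X\<close> \<open>card T \<le> card Y\<close> by (auto simp: \<sigma>_def \<theta>_def)
  have eq: "real (card S) * real (card T) * edges X Y / M\<^sup>2 = \<sigma> * \<theta> * q * edges X Y"
    unfolding ST' q_def by (simp add: mult_ac)
  have e0: "edges X Y \<ge> 0" by (simp add: edges_def)
  have "\<bar>\<sigma> * (edges X T - \<theta> * edges X Y)\<bar> \<le> 1 * (\<kappa> * (M * D))"
    unfolding abs_mult using \<sigma> 2 by (intro mult_mono) (auto simp: \<theta>_def)
  moreover have "\<bar>(\<sigma> * \<theta>) * ((1 - q) * edges X Y)\<bar> \<le> 1 * (\<tau>\<^sup>2 * edges X Y)"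
  proof -
    have "\<sigma> * \<theta> \<le> 1" using \<sigma> \<theta> by (simp add: mult_le_one)
    moreover have "(1 - q) * edges X Y \<le> \<tau>\<^sup>2 * edges X Y"
      using q e0 by (intro mult_right_mono) auto
    ultimately have "(\<sigma> * \<theta>) * ((1 - q) * edges X Y) \<le> 1 * (\<tau>\<^sup>2 * edges X Y)"
      using \<sigma> \<theta> q e0 by (intro mult_mono) auto
    moreover have "0 \<le> (\<sigma> * \<theta>) * ((1 - q) * edges X Y)" using \<sigma> \<theta> q e0 by simp
    ultimately show ?thesis by simp
  qed
  moreover have "edges S T - \<sigma> * \<theta> * q * edges X Y = (edges S T - \<sigma> * edges X T)
    + \<sigma> * (edges X T - \<theta> * edges X Y) + (\<sigma> * \<theta>) * ((1 - q) * edges X Y)"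
    by (simp add: algebra_simps)
  ultimately show ?thesis using 1 unfolding eq \<sigma>_def[symmetric] by linarith
qed

end

section \<open>Dense cores\<close>

text \<open>An extremal choice stands in for iterated deletion. If \<open>U\<close> maximises the
  number of arcs inside minus \<open>2 * c * card U\<close>, dropping a vertex with fewer than
  \<open>c\<close> neighbours in \<open>U\<close> would increase this, each neighbour accounting for
  two arcs. Comparing \<open>U\<close> with \<open>V\<close> bounds the loss.\<close>

lemma exists_dense_core:
  fixes E :: "('a \<times> 'a) set" and c :: real
  assumes V: "finite V" "E \<subseteq> V \<times> V" and sym: "sym E"
  obtains U where "U \<subseteq> V"
    "\<And>x. x \<in> U \<Longrightarrow> c \<le> real (card ((E \<inter> U \<times> U) `` {x}))"
    "real (card E) \<le> real (card (E \<inter> U \<times> U)) + 2 * c * (real (card V) - real (card U))"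
proof -
  define \<phi> where "\<phi> U = real (card (E \<inter> U \<times> U)) - 2 * c * real (card U)" for U
  have fin: "finite (\<phi> ` Pow V)" "\<phi> ` Pow V \<noteq> {}" using V by auto
  obtain U where U: "U \<in> Pow V" "\<phi> U = Max (\<phi> ` Pow V)" using Max_in[OF fin] by fastforce
  have max: "\<phi> U' \<le> \<phi> U" if "U' \<subseteq> V" for U' using Max_ge[OF fin(1)] that U by simp
  have "finite U" using U V finite_subset by auto
  show thesis
  proof
    show "U \<subseteq> V" using U by simp
    have "E \<inter> V \<times> V = E" using V by auto
    then show "real (card E) \<le> real (card (E \<inter> U \<times> U)) + 2 * c * (real (card V) - real (card U))"
      using max[of V] by (simp add: \<phi>_def algebra_simps)
  next
    fix x assume x: "x \<in> U"
    define N where "N = (E \<inter> U \<times> U) `` {x}"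
    define U' where "U' = U - {x}"
    have N: "finite N" unfolding N_def using \<open>finite U\<close> by (auto intro: finite_subset[of _ U])
    have "E \<inter> U \<times> U \<subseteq> E \<inter> U' \<times> U' \<union> ({x} \<times> N \<union> N \<times> {x})"
      using sym by (auto simp: N_def U'_def dest: symD)
    then have "card (E \<inter> U \<times> U) \<le> card (E \<inter> U' \<times> U' \<union> ({x} \<times> N \<union> N \<times> {x}))"
      using N \<open>finite U\<close> by (intro card_mono) (auto simp: U'_def)
    also have "\<dots> \<le> card (E \<inter> U' \<times> U') + (card N + card N)"
      using card_Un_le[of "E \<inter> U' \<times> U'" "{x} \<times> N \<union> N \<times> {x}"]
        card_Un_le[of "{x} \<times> N" "N \<times> {x}"] by (simp add: card_cartesian_product)
    finally have "real (card (E \<inter> U \<times> U)) \<le> real (card (E \<inter> U' \<times> U')) + 2 * real (card N)"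
      by linarith
    moreover have "real (card U) = real (card U') + 1"
      using card.remove[OF \<open>finite U\<close> x] by (simp add: U'_def)
    moreover have "\<phi> U' \<le> \<phi> U" by (rule max) (use U in \<open>auto simp: U'_def\<close>)
    ultimately show "c \<le> real (card N)" by (simp add: \<phi>_def algebra_simps)
  qed
qed

section \<open>Cycles and degrees in the graph representation\<close>

text \<open>The copy is the image of the cycle under \<open>w\<close>; its arcs against the cyclic
  direction lie in \<open>G\<close> by symmetry.\<close>

lemma contains_copy_cycle_graph:
  fixes G :: "'a pair_pre_digraph"
  assumes G: "pair_graph G" and j: "j \<ge> 3" and inj: "inj_on w {..<j}"
    and arcs: "\<And>i. i < j \<Longrightarrow> (w i, w (Suc i mod j)) \<in> parcs G"
  shows "contains_copy G (cycle_graph j)"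
proof -
  interpret G: pair_graph G by (rule G)
  interpret C: pair_graph "cycle_graph j" by (rule pair_graph_cycle_graph[OF j])
  define f where "f = \<lparr> iso_verts = w, iso_arcs = map_prod w w, iso_head = snd, iso_tail = fst \<rparr>"
  define H where "H = \<lparr> pverts = w ` {..<j}, parcs = map_prod w w ` parcs (cycle_graph j) \<rparr>"
  have sym: "(v, u) \<in> parcs G" if "(u, v) \<in> parcs G" for u v
    using that G.pair_sym_arcs by (auto simp: symmetric_def dest: symD)
  have sub: "parcs H \<subseteq> parcs G"
    using arcs sym by (auto simp: H_def cycle_graph_def)
  have H: "pair_wf_digraph H"
    by unfold_locales (auto simp: H_def cycle_graph_def)
  have "pverts H \<subseteq> pverts G"
    using arcs G.in_arcsD1 by (auto simp: H_def)
  then have "subgraph (with_proj H) (with_proj G)"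
    using sub H G.pair_wf_digraph_axioms
    by (intro subgraphI) (auto simp: wf_digraph_wp_iff)
  moreover have "digraph_iso (with_proj (cycle_graph j)) (with_proj H)"
    unfolding digraph_iso_def
  proof (intro exI conjI)
    have "inj_on (map_prod w w) (parcs (cycle_graph j))"
      by (rule inj_on_subset[OF map_prod_inj_on[OF inj inj]]) (auto simp: cycle_graph_def)
    then show "pre_digraph.digraph_isomorphism (with_proj (cycle_graph j)) f"
      using inj C.wf_digraph_axioms
      by (auto simp: pre_digraph.digraph_isomorphism_def f_def cycle_graph_def)
    show "with_proj H = app_iso f (with_proj (cycle_graph j))"
      by (simp add: app_iso_def f_def H_def with_proj_def cycle_graph_def)
  qed
  ultimately show ?thesis unfolding contains_copy_def by blast
qed

lemma sum_out_degree:
  assumes "pair_graph G"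
  shows "(\<Sum>v\<in>pverts G. real (out_degree (with_proj G) v)) = real (card (parcs G))"
proof -
  interpret pair_graph G by (rule assms)
  have "(\<Sum>v\<in>pverts G. card (out_arcs (with_proj G) v)) = card (\<Union>v\<in>pverts G. out_arcs (with_proj G) v)"
    using pair_finite_verts pair_finite_arcs
    by (intro card_UN_disjoint[symmetric]) (auto simp: out_arcs_def)
  also have "(\<Union>v\<in>pverts G. out_arcs (with_proj G) v) = parcs G"
    using in_arcsD1 by (auto simp: out_arcs_def)
  finally show ?thesis by (simp add: out_degree_def flip: of_nat_sum)
qed

section \<open>Removing the maximum degree bound\<close>

context bipartite_girth
begin

text \<open>Only arcs are removed, so the parts keep their sizes and discarded vertices become
  isolated. This is why the minimum degree hypotheses concern non-isolated vertices only.\<close>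

lemma restrict: "bipartite_girth X Y (E \<inter> U \<times> U) l"
proof
  show "sym (E \<inter> U \<times> U)" using sym_arcs by (auto intro!: symI dest: symD)
  fix k w assume "2 \<le> k" "k \<le> l" "inj_on w {..<2 * k}"
    "\<And>i. i < 2 * k \<Longrightarrow> (w i, w (Suc i mod (2 * k))) \<in> E \<inter> U \<times> U"
  then show False using no_cycle[of k w] by blast
qed (use finite_X finite_Y disjoint arcs_subset in auto)

lemma card_arcs: "real (card E) = 2 * edges X Y"
proof -
  have "E = E \<inter> X \<times> Y \<union> E \<inter> Y \<times> X" using arcs_subset by auto
  moreover have "card (E \<inter> X \<times> Y \<union> E \<inter> Y \<times> X) = card (E \<inter> X \<times> Y) + card (E \<inter> Y \<times> X)"
    using finite_arcs disjoint by (intro card_Un_disjoint) auto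
  ultimately show ?thesis using edges_commute[of X Y] by (simp add: edges_def)
qed

text \<open>The bounded-degree case is applied to a core of minimum degree \<open>c\<close>, whose
  maximum degree is at most \<open>2 * M / (c - 1) ^ (l - 1)\<close>. At most
  \<open>2 * c * M\<close> edges are lost, which changes \<open>edges S T\<close> and the main term
  by at most that amount each.\<close>

lemma discrepancy_of_size_le:
  assumes l: "l \<ge> 1" and ST: "S \<subseteq> X" "T \<subseteq> Y"
    and M: "M > 0" "real (card X) + real (card Y) = 2 * M" and D: "D > 0" "D ^ l = M"
    and \<tau>: "0 < \<tau>" "\<tau> \<le> 1" and c: "c > 1"
    and \<eta>: "real l * (2 * M / (c - 1) ^ (l - 1)) ^ (l - 1) \<le> \<tau>\<^sup>2 / 6 * M"
    and e: "2 * c * M \<le> edges X Y"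
      "(1 - \<tau>\<^sup>2 / 2) * M ^ (2 * l + 2) \<le> (edges X Y - 2 * c * M) ^ (2 * l)"
    and \<kappa>: "0 \<le> \<kappa>" "12 * 4 ^ l * \<tau> \<le> \<kappa> ^ (2 * l)"
  shows "\<bar>edges S T - real (card S) * real (card T) * edges X Y / M\<^sup>2\<bar>
    \<le> 2 * \<kappa> * (M * D) + \<tau>\<^sup>2 * edges X Y + 4 * c * M"
proof -
  have V: "finite (X \<union> Y)" "E \<subseteq> (X \<union> Y) \<times> (X \<union> Y)"
    using finite_X finite_Y arcs_subset by auto
  have cV: "real (card (X \<union> Y)) = 2 * M"
    using M finite_X finite_Y disjoint by (simp add: card_Un_disjoint)
  obtain U where U: "U \<subseteq> X \<union> Y" "\<And>x. x \<in> U \<Longrightarrow> c \<le> real (card ((E \<inter> U \<times> U) `` {x}))"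
    "real (card E) \<le> real (card (E \<inter> U \<times> U)) + 2 * c * (real (card (X \<union> Y)) - real (card U))"
    using exists_dense_core[OF V sym_arcs, of c] by blast
  define E' where "E' = E \<inter> U \<times> U"
  interpret s: bipartite_girth X Y E' l unfolding E'_def by (rule restrict)
  have min: "c \<le> real (card (E' `` {x}))" if "E' `` {x} \<noteq> {}" for x
    using that U(2)[of x] by (auto simp: E'_def)
  define \<Delta> where "\<Delta> = 2 * M / (c - 1) ^ (l - 1)"
  have deg: "s.deg_le \<Delta>"
    using s.max_degree_le[OF min _ l] c M cV
    by (auto simp: s.deg_le_def \<Delta>_def pos_le_divide_eq)
  \<comment> \<open>There are two arcs per edge, so losing at most \<open>4 * c * M\<close> arcs
    means losing at most \<open>2 * c * M\<close> edges.\<close>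
  have "c * real (card U) \<ge> 0" using c by simp
  then have loss: "edges X Y \<le> s.edges X Y + 2 * c * M"
    using U(3) card_arcs s.card_arcs unfolding cV E'_def[symmetric] by (simp add: algebra_simps)
  have diff: "s.edges A B \<le> edges A B" "edges A B - s.edges A B \<le> edges X Y - s.edges X Y"
    if "A \<subseteq> X" "B \<subseteq> Y" for A B
  proof -
    have "real (card (E \<inter> A \<times> B)) = real (card (E' \<inter> A \<times> B)) + real (card ((E - E') \<inter> A \<times> B))" for A B
    proof -
      have "E \<inter> A \<times> B = E' \<inter> A \<times> B \<union> (E - E') \<inter> A \<times> B" by (auto simp: E'_def)
      moreover have "card (E' \<inter> A \<times> B \<union> (E - E') \<inter> A \<times> B)
          = card (E' \<inter> A \<times> B) + card ((E - E') \<inter> A \<times> B)"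
        using finite_arcs by (intro card_Un_disjoint) (auto simp: E'_def)
      ultimately show ?thesis by simp
    qed
    moreover have "card ((E - E') \<inter> A \<times> B) \<le> card ((E - E') \<inter> X \<times> Y)"
      using that finite_arcs by (intro card_mono) auto
    ultimately show "s.edges A B \<le> edges A B" "edges A B - s.edges A B \<le> edges X Y - s.edges X Y"
      unfolding edges_def s.edges_def by auto
  qed
  have "(edges X Y - 2 * c * M) ^ (2 * l) \<le> s.edges X Y ^ (2 * l)"
    using e loss by (intro power_mono) auto
  then have e': "(1 - \<tau>\<^sup>2 / 2) * M ^ (2 * l + 2) \<le> s.edges X Y ^ (2 * l)" using e by simp
  have main: "\<bar>s.edges S T - real (card S) * real (card T) * s.edges X Y / M\<^sup>2\<bar>
    \<le> 2 * \<kappa> * (M * D) + \<tau>\<^sup>2 * s.edges X Y"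
    by (rule s.discrepancy_le[OF deg l ST M D \<tau> _ e' \<kappa>]) (use \<eta> in \<open>simp add: \<Delta>_def\<close>)
  \<comment> \<open>This is the change of the main term; its coefficient is at most 1 because
    \<open>card X * card Y \<le> M\<^sup>2\<close>.\<close>
  define r where "r = real (card S) * real (card T) / M\<^sup>2 * (edges X Y - s.edges X Y)"
  have "\<tau>\<^sup>2 * s.edges X Y \<le> \<tau>\<^sup>2 * edges X Y" using diff[of X Y] by (intro mult_left_mono) auto
  moreover have "0 \<le> r" using diff[of X Y] by (simp add: r_def)
  moreover have "r \<le> 1 * (2 * c * M)"
    unfolding r_def
  proof (rule mult_mono)
    have "card S \<le> card X" "card T \<le> card Y" using ST finite_X finite_Y by (auto intro: card_mono)
    then have "real (card S) * real (card T) \<le> real (card X) * real (card Y)" by (intro mult_mono) auto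
    also have "\<dots> \<le> M\<^sup>2"
    proof -
      have b: "real (card Y) = 2 * M - real (card X)" using M by simp
      have "0 \<le> (real (card X) - M)\<^sup>2" by simp
      then show ?thesis unfolding b by (simp add: power2_eq_square algebra_simps)
    qed
    finally show "real (card S) * real (card T) / M\<^sup>2 \<le> 1" using M by simp
  qed (use loss diff[of X Y] in auto)
  moreover have "real (card S) * real (card T) * edges X Y / M\<^sup>2
    = real (card S) * real (card T) * s.edges X Y / M\<^sup>2 + r"
    by (simp add: r_def algebra_simps add_divide_distrib diff_divide_distrib)
  moreover have "0 \<le> edges S T - s.edges S T" "edges S T - s.edges S T \<le> 2 * c * M"
    using diff[OF ST] loss by auto
  ultimately show ?thesis using main by linarith
qed

end

section \<open>Choice of the parameters\<close>

text \<open>The thresholds depend on \<open>\<delta>\<close> and \<open>l\<close> alone, so the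
  bound is uniform in the graph and in \<open>S\<close> and \<open>T\<close>. Taking the core with
  \<open>c = \<epsilon> * D\<close> loses few edges and still bounds the maximum degree by
  \<open>C * D\<close>.\<close>

lemma discrepancy_asymptotic:
  fixes \<delta> :: real
  assumes \<delta>: "\<delta> > 0" and l: "l \<ge> 1"
  obtains \<epsilon> D0 where "\<epsilon> > 0"
    "\<And>(X :: 'a set) Y E S T M D. \<lbrakk>bipartite_girth X Y E l; S \<subseteq> X; T \<subseteq> Y; D \<ge> D0; D > 0; D ^ l = M;
      real (card X) + real (card Y) = 2 * M; \<bar>bipartite_arcs.edges E X Y - M * D\<bar> \<le> \<epsilon> * (M * D)\<rbrakk>
      \<Longrightarrow> \<bar>bipartite_arcs.edges E S T - real (card S) * real (card T) * bipartite_arcs.edges E X Y / M\<^sup>2\<bar>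
        \<le> \<delta> * (M * D)"
proof -
  define \<kappa> where "\<kappa> = \<delta> / 8"
  \<comment> \<open>The final budget is
    \<open>2 * \<kappa> + 2 * \<tau> + 4 * \<epsilon> \<le> \<delta>\<close>; the last entry of the
    minimum makes \<open>\<tau>\<close> small enough for the \<open>2 * l\<close>-th root to be at
    most \<open>\<kappa>\<close>.\<close>
  define \<tau> where "\<tau> = min (min 1 (\<delta> / 8)) (\<kappa> ^ (2 * l) / (12 * 4 ^ l))"
  have \<kappa>0: "\<kappa> > 0" using \<delta> by (simp add: \<kappa>_def)
  have \<tau>: "0 < \<tau>" "\<tau> \<le> 1" "\<tau> \<le> \<delta> / 8" using \<delta> \<kappa>0 by (auto simp: \<tau>_def)
  have "\<tau> \<le> \<kappa> ^ (2 * l) / (12 * 4 ^ l)" by (simp add: \<tau>_def)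
  then have \<kappa>: "0 \<le> \<kappa>" "12 * 4 ^ l * \<tau> \<le> \<kappa> ^ (2 * l)"
    using \<kappa>0 by (auto simp: field_simps)
  have \<tau>2: "\<tau>\<^sup>2 \<le> \<tau>" "\<tau>\<^sup>2 \<le> 1" "\<tau>\<^sup>2 > 0"
    using \<tau> mult_left_mono[of \<tau> 1 \<tau>] by (auto simp: power2_eq_square mult_le_one)
  \<comment> \<open>Chosen so that Bernoulli's inequality gives
    \<open>1 - \<tau>\<^sup>2 / 2 \<le> (1 - 3 * \<epsilon>) ^ (2 * l)\<close>.\<close>
  define \<epsilon> where "\<epsilon> = \<tau>\<^sup>2 / (12 * real l)"
  have \<epsilon>: "\<epsilon> > 0" using \<tau>2 l by (simp add: \<epsilon>_def)
  have l\<epsilon>: "real l * \<epsilon> = \<tau>\<^sup>2 / 12" using l by (simp add: \<epsilon>_def)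
  have "1 * \<epsilon> \<le> real l * \<epsilon>" using \<epsilon> l by (intro mult_right_mono) auto
  then have \<epsilon>': "\<epsilon> \<le> \<tau>\<^sup>2 / 12" using l\<epsilon> by simp
  define C where "C = 2 * (2 / \<epsilon>) ^ (l - 1)"
  \<comment> \<open>The first bound gives \<open>c \<ge> 4\<close> and thereby
    \<open>c - 1 \<ge> c / 2\<close>; the second makes \<open>real l * (C * D) ^ (l - 1)\<close> at
    most \<open>\<tau>\<^sup>2 / 6 * D ^ l\<close>.\<close>
  define D0 where "D0 = max (4 / \<epsilon>) (6 * real l * C ^ (l - 1) / \<tau>\<^sup>2)"
  show thesis
  proof
    show "\<epsilon> > 0" by (rule \<epsilon>)
    fix X Y S T :: "'a set" and E M D
    assume G: "bipartite_girth X Y E l" and ST: "S \<subseteq> X" "T \<subseteq> Y" and D: "D \<ge> D0" "D > 0" "D ^ l = M"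
      and M: "real (card X) + real (card Y) = 2 * M"
      and e: "\<bar>bipartite_arcs.edges E X Y - M * D\<bar> \<le> \<epsilon> * (M * D)"
    interpret bipartite_girth X Y E l by (rule G)
    have M0: "M > 0" using D by auto
    have MD: "M * D > 0" using M0 D by simp
    define c where "c = \<epsilon> * D"
    obtain k where k: "l = Suc k" using l by (cases l) auto
    have "4 / \<epsilon> \<le> D" using D by (simp add: D0_def)
    then have c4: "c \<ge> 4" using \<epsilon> by (simp add: c_def field_simps)
    have "2 * M / (c - 1) ^ k \<le> 2 * M / (\<epsilon> * D / 2) ^ k"
      using c4 M0 \<epsilon> D by (intro divide_left_mono power_mono mult_pos_pos zero_less_power)
        (auto simp: c_def mult.commute)
    also have "\<epsilon> * D / 2 = D / (2 / \<epsilon>)" by simp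
    also have "2 * M / (D / (2 / \<epsilon>)) ^ k = 2 * (D * D ^ k) / (D ^ k / (2 / \<epsilon>) ^ k)"
      by (simp only: power_divide D(3)[symmetric] k power_Suc)
    also have "\<dots> = C * D"
      using \<epsilon> D(2) by (simp add: C_def k)
    finally have \<Delta>: "2 * M / (c - 1) ^ (l - 1) \<le> C * D" by (simp add: k)
    have "real l * (2 * M / (c - 1) ^ (l - 1)) ^ (l - 1) \<le> real l * (C * D) ^ (l - 1)"
      using \<Delta> M0 c4 by (intro mult_left_mono power_mono) auto
    also have "\<dots> = (real l * C ^ (l - 1)) * D ^ (l - 1)" by (simp add: power_mult_distrib)
    also have "\<dots> \<le> (\<tau>\<^sup>2 / 6 * D) * D ^ (l - 1)"
    proof (rule mult_right_mono)
      have "6 * real l * C ^ (l - 1) / \<tau>\<^sup>2 \<le> D" using D by (simp add: D0_def)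
      then show "real l * C ^ (l - 1) \<le> \<tau>\<^sup>2 / 6 * D" using \<tau>2 by (simp add: field_simps)
    qed (use D in simp)
    also have "\<dots> = \<tau>\<^sup>2 / 6 * M" using D k by simp
    finally have \<eta>: "real l * (2 * M / (c - 1) ^ (l - 1)) ^ (l - 1) \<le> \<tau>\<^sup>2 / 6 * M" .
    \<comment> \<open>One \<open>\<epsilon>\<close> is the deviation of the edge count, the other
      two come from \<open>2 * c * M\<close>.\<close>
    have lower: "(1 - 3 * \<epsilon>) * (M * D) \<le> edges X Y - 2 * c * M"
      using e by (simp add: c_def algebra_simps)
    have "3 * \<epsilon> \<le> 1" using \<epsilon>' \<tau>2 by simp
    then have nonneg: "0 \<le> (1 - 3 * \<epsilon>) * (M * D)" using MD by simp
    have "1 - \<tau>\<^sup>2 / 2 = 1 + real (2 * l) * (- (3 * \<epsilon>))" using l\<epsilon> by simp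
    also have "\<dots> \<le> (1 + - (3 * \<epsilon>)) ^ (2 * l)"
      using \<open>3 * \<epsilon> \<le> 1\<close> by (intro Bernoulli_inequality) simp
    finally have "(1 - \<tau>\<^sup>2 / 2) * (M * D) ^ (2 * l) \<le> ((1 - 3 * \<epsilon>) * (M * D)) ^ (2 * l)"
      unfolding power_mult_distrib[of "1 - 3 * \<epsilon>"] using MD by (intro mult_right_mono) auto
    also have "\<dots> \<le> (edges X Y - 2 * c * M) ^ (2 * l)"
      using lower nonneg by (rule power_mono)
    also have "(M * D) ^ (2 * l) = M ^ (2 * l + 2)"
      using D(3) by (simp add: power_mult_distrib power_even_eq[of D] power_add power2_eq_square)
    finally have e1: "(1 - \<tau>\<^sup>2 / 2) * M ^ (2 * l + 2) \<le> (edges X Y - 2 * c * M) ^ (2 * l)" .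
    have "\<bar>edges S T - real (card S) * real (card T) * edges X Y / M\<^sup>2\<bar>
      \<le> 2 * \<kappa> * (M * D) + \<tau>\<^sup>2 * edges X Y + 4 * c * M"
      by (rule discrepancy_of_size_le[OF l ST M0 M D(2,3) \<tau>(1,2) _ \<eta> _ e1 \<kappa>])
        (use c4 lower nonneg in auto)
    also have "\<dots> \<le> 2 * \<kappa> * (M * D) + \<tau> * (2 * (M * D)) + 4 * \<epsilon> * (M * D)"
    proof -
      have "\<epsilon> * (M * D) \<le> 1 * (M * D)" using \<epsilon>' \<tau>2 MD by (intro mult_right_mono) auto
      then have "edges X Y \<le> 2 * (M * D)" using e by simp
      then have "\<tau>\<^sup>2 * edges X Y \<le> \<tau> * (2 * (M * D))"
        using \<tau>(1) \<tau>2(1) by (intro mult_mono) (auto simp: edges_def)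
      then show ?thesis by (simp add: c_def)
    qed
    also have "\<dots> = (2 * \<kappa> + 2 * \<tau> + 4 * \<epsilon>) * (M * D)" by (simp add: algebra_simps)
    also have "\<dots> \<le> \<delta> * (M * D)"
    proof (rule mult_right_mono)
      show "2 * \<kappa> + 2 * \<tau> + 4 * \<epsilon> \<le> \<delta>"
        using \<tau> \<tau>2 \<epsilon>' unfolding \<kappa>_def by linarith
    qed (use MD in simp)
    finally show "\<bar>edges S T - real (card S) * real (card T) * edges X Y / M\<^sup>2\<bar> \<le> \<delta> * (M * D)" .
  qed
qed

section \<open>Sequences of graphs without the given even cycles\<close>

lemma bipartite_girth_of_family_free:
  assumes G: "pair_graph G" and parts: "bipartite_with_parts G X Y"
    and free: "family_free (even_cycles l) G"
  shows "bipartite_girth X Y (parcs G) l"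
proof -
  interpret pair_graph G by (rule G)
  show ?thesis
  proof
    show "finite X" "finite Y"
      using parts pair_finite_verts by (auto simp: bipartite_with_parts_def)
    show "X \<inter> Y = {}" "parcs G \<subseteq> X \<times> Y \<union> Y \<times> X"
      using parts by (auto simp: bipartite_with_parts_def)
    show "sym (parcs G)" using pair_sym_arcs by (simp add: symmetric_def)
    fix k w
    assume k: "2 \<le> k" "k \<le> l" and w: "inj_on w {..<2 * k}"
      "\<And>i. i < 2 * k \<Longrightarrow> (w i, w (Suc i mod (2 * k))) \<in> parcs G"
    have "contains_copy G (cycle_graph (2 * k))"
      by (rule contains_copy_cycle_graph[OF G _ w]) (use k in auto)
    then show False using free k by (auto simp: family_free_def even_cycles_def)
  qed
qed

theorem theorem5p1:
  fixes l :: nat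
    and G :: "nat \<Rightarrow> 'a pair_pre_digraph"
    and X Y :: "nat \<Rightarrow> 'a set"
    and n :: "nat \<Rightarrow> nat"
    and d :: "nat \<Rightarrow> real"
  assumes "l \<ge> 2"
    and "\<And>i. pair_graph (G i)"
    and "\<And>i. bipartite_with_parts (G i) (X i) (Y i)"
    and "\<And>i. family_free (even_cycles l) (G i)"
    and "\<And>i. n i = card (pverts (G i))"
    and "\<And>i. d i = average_degree (G i)"
    and "filterlim n at_top sequentially"
    and "d \<sim>[sequentially] (\<lambda>i. (real (n i) / 2) powr (1 / real l))"
  shows "\<exists>err \<in> o[sequentially](\<lambda>i. real (n i) powr (1 + 1 / real l)).
           \<forall>i. \<forall>S \<subseteq> X i. \<forall>T \<subseteq> Y i.
             \<bar>real (edge_count (G i) S T) - 2 * d i / real (n i) * real (card S) * real (card T)\<bar>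
               \<le> err i"
proof -
  define M where "M i = real (n i) / 2" for i
  define D where "D i = M i powr (1 / real l)" for i
  define dev where "dev i S T = \<bar>real (edge_count (G i) S T)
    - 2 * d i / real (n i) * real (card S) * real (card T)\<bar>" for i S T
  \<comment> \<open>The error term will be \<open>Max (A i)\<close>, a maximum over finitely many
    pairs, which makes it uniform in \<open>S\<close> and \<open>T\<close>.\<close>
  define A where "A i = (\<lambda>(S, T). dev i S T) ` (Pow (X i) \<times> Pow (Y i))" for i
  have girth: "bipartite_girth (X i) (Y i) (parcs (G i)) l" for i
    by (rule bipartite_girth_of_family_free[OF assms(2-4)])
  have arcs: "bipartite_arcs (X i) (Y i) (parcs (G i))" for i
    using girth[of i] by (simp add: bipartite_girth_def)
  note edges_def = bipartite_arcs.edges_def[OF arcs]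
  have A: "finite (A i)" "A i \<noteq> {}" for i
    using bipartite_arcs.finite_X[OF arcs] bipartite_arcs.finite_Y[OF arcs] by (auto simp: A_def)
  have sizes: "real (card (X i)) + real (card (Y i)) = 2 * M i" for i
  proof -
    have "card (X i \<union> Y i) = card (X i) + card (Y i)"
      using arcs[of i] by (auto simp: bipartite_arcs_def card_Un_disjoint)
    then show ?thesis using assms(3)[of i] assms(5)[of i] by (simp add: bipartite_with_parts_def M_def)
  qed
  \<comment> \<open>The degree sum gives \<open>n i * d i\<close> arcs, that is
    \<open>2 * M i * d i\<close>, two for each edge.\<close>
  have edges: "bipartite_arcs.edges (parcs (G i)) (X i) (Y i) = M i * d i" if "n i > 0" for i
    using bipartite_girth.card_arcs[OF girth, of i] sum_out_degree[OF assms(2), of i] that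
    by (simp add: assms(6) average_degree_def M_def flip: assms(5))
  have dev: "dev i S T = \<bar>bipartite_arcs.edges (parcs (G i)) S T
      - real (card S) * real (card T) * bipartite_arcs.edges (parcs (G i)) (X i) (Y i) / (M i)\<^sup>2\<bar>"
    if "n i > 0" for i S T
  proof -
    have "{(s, t). s \<in> S \<and> t \<in> T \<and> (s, t) \<in> parcs (G i)} = parcs (G i) \<inter> S \<times> T" by auto
    then have "real (edge_count (G i) S T) = bipartite_arcs.edges (parcs (G i)) S T"
      by (simp add: edge_count_def edges_def)
    moreover have "2 * d i / real (n i) * real (card S) * real (card T)
      = real (card S) * real (card T) * (M i * d i) / (M i)\<^sup>2"
      using that by (simp add: M_def field_simps power2_eq_square)
    ultimately show ?thesis by (simp add: dev_def edges[OF that])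
  qed
  have D_lim: "filterlim D at_top sequentially"
  proof -
    have "filterlim (\<lambda>i. real (n i)) at_top sequentially"
      by (rule filterlim_compose[OF filterlim_real_sequentially assms(7)])
    then have "filterlim (\<lambda>i. 1 / 2 * real (n i)) at_top sequentially"
      by (intro filterlim_tendsto_pos_mult_at_top[OF tendsto_const]) auto
    then have "filterlim M at_top sequentially" by (simp add: M_def[abs_def])
    then show ?thesis
      unfolding filterlim_at_top
    proof (intro allI)
      fix z :: real
      assume "\<forall>z. eventually (\<lambda>i. z \<le> M i) sequentially"
      \<comment> \<open>\<open>D\<close> is an \<open>l\<close>-th root of \<open>M\<close>, so
        \<open>M\<close> is compared with an \<open>l\<close>-th power; the maximum with 1 keeps its
        base positive.\<close>
      then have "eventually (\<lambda>i. max z 1 ^ l \<le> M i) sequentially" by blast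
      then show "eventually (\<lambda>i. z \<le> D i) sequentially"
      proof eventually_elim
        case (elim i)
        have "max z 1 = (max z 1 ^ l) powr (1 / real l)"
          using assms(1) by (simp add: powr_powr flip: powr_realpow)
        also have "\<dots> \<le> D i" unfolding D_def using elim by (intro powr_mono2) auto
        finally show ?case by simp
      qed
    qed
  qed
  have n_pos: "eventually (\<lambda>i. n i > 0) sequentially"
    using assms(7) eventually_gt_at_top[of 0] by (simp add: filterlim_iff)
  have "(\<lambda>i. Max (A i)) \<in> o[sequentially](\<lambda>i. real (n i) powr (1 + 1 / real l))"
  proof (rule landau_o.smallI)
    fix \<delta> :: real assume "\<delta> > 0"
    have "l \<ge> 1" using assms(1) by simp
    obtain \<epsilon> D0 where \<epsilon>: "\<epsilon> > 0" and main:
      "\<And>(X :: 'a set) Y E S T M D. \<lbrakk>bipartite_girth X Y E l; S \<subseteq> X; T \<subseteq> Y; D \<ge> D0; D > 0; D ^ l = M;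
      real (card X) + real (card Y) = 2 * M; \<bar>bipartite_arcs.edges E X Y - M * D\<bar> \<le> \<epsilon> * (M * D)\<rbrakk>
      \<Longrightarrow> \<bar>bipartite_arcs.edges E S T - real (card S) * real (card T) * bipartite_arcs.edges E X Y / M\<^sup>2\<bar>
        \<le> \<delta> * (M * D)"
      using discrepancy_asymptotic[OF \<open>\<delta> > 0\<close> \<open>l \<ge> 1\<close>, where ?'a = 'a] by blast
    have "eventually (\<lambda>i. \<bar>d i - D i\<bar> \<le> \<epsilon> * D i) sequentially"
    proof -
      \<comment> \<open>Asymptotic equivalence sets the quotient to 1 where both sides vanish; this
        cannot happen once \<open>n i > 0\<close>, since then \<open>D i > 0\<close>.\<close>
      have "((\<lambda>i. if d i = 0 \<and> D i = 0 then 1 else d i / D i) \<longlongrightarrow> 1) sequentially"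
        using assms(8) unfolding asymp_equiv_def D_def M_def .
      then have "eventually (\<lambda>i. dist (if d i = 0 \<and> D i = 0 then 1 else d i / D i) 1 < \<epsilon>) sequentially"
        using \<epsilon> by (simp add: tendsto_iff)
      then show ?thesis using n_pos
      proof eventually_elim
        case (elim i)
        then have D: "D i > 0" by (simp add: D_def M_def)
        then have "\<bar>d i / D i - 1\<bar> < \<epsilon>" using elim by (simp add: dist_real_def)
        moreover have "d i - D i = (d i / D i - 1) * D i" using D by (simp add: field_simps)
        ultimately show ?case using D by (simp add: abs_mult)
      qed
    qed
    moreover have "eventually (\<lambda>i. D i \<ge> D0) sequentially"
      using D_lim by (simp add: filterlim_at_top)
    ultimately show "eventually (\<lambda>i. norm (Max (A i)) \<le> \<delta> * norm (real (n i) powr (1 + 1 / real l))) sequentially"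
      using n_pos
    proof eventually_elim
      case (elim i)
      have M: "M i > 0" using elim by (simp add: M_def)
      have D: "D i > 0" "D i ^ l = M i"
        using M assms(1) by (auto simp: D_def powr_power)
      have "\<bar>M i * d i - M i * D i\<bar> = M i * \<bar>d i - D i\<bar>"
        using M by (simp add: abs_mult flip: right_diff_distrib)
      also have "\<dots> \<le> \<epsilon> * (M i * D i)"
        using M elim mult_left_mono[of "\<bar>d i - D i\<bar>" "\<epsilon> * D i" "M i"] by (simp add: mult_ac)
      finally have e: "\<bar>bipartite_arcs.edges (parcs (G i)) (X i) (Y i) - M i * D i\<bar> \<le> \<epsilon> * (M i * D i)"
        using edges elim by simp
      have "dev i S T \<le> \<delta> * (M i * D i)" if "S \<subseteq> X i" "T \<subseteq> Y i" for S T
        using main[OF girth that _ D sizes e] elim dev[of i S T] by simp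
      then have "Max (A i) \<le> \<delta> * (M i * D i)"
        using A by (auto simp: A_def)
      moreover have "0 \<le> Max (A i)"
      proof -
        obtain a where "a \<in> A i" using A(2) by blast
        then have "0 \<le> a" by (auto simp: A_def dev_def)
        then show ?thesis using Max_ge[OF A(1) \<open>a \<in> A i\<close>] by simp
      qed
      moreover have "\<delta> * (M i * D i) \<le> \<delta> * real (n i) powr (1 + 1 / real l)"
      proof (rule mult_left_mono)
        have "M i * D i = M i powr (1 + 1 / real l)" using M by (simp add: D_def powr_add)
        also have "\<dots> \<le> real (n i) powr (1 + 1 / real l)"
          using M by (intro powr_mono2) (auto simp: M_def)
        finally show "M i * D i \<le> real (n i) powr (1 + 1 / real l)" .
      qed (use \<open>\<delta> > 0\<close> in simp)
      ultimately show ?case by simp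
    qed
  qed
  then show ?thesis
  proof (rule bexI[rotated], intro allI impI)
    fix i S T
    assume "S \<subseteq> X i" "T \<subseteq> Y i"
    then have "dev i S T \<in> A i" by (force simp: A_def)
    then show "\<bar>real (edge_count (G i) S T) - 2 * d i / real (n i) * real (card S) * real (card T)\<bar>
        \<le> Max (A i)"
      unfolding dev_def by (rule Max_ge[OF A(1)])
  qed
qed

end
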